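(* Let $P \subseteq \mathbb{R}^{d_P}$ and $Q \subseteq \mathbb{R}^{d_Q}$ be non-empty polytopes such that at least one of $P$ and $Q$ is a pyramid. Then $\operatorname{xc}(P \times Q) = \operatorname{xc}(P) + \operatorname{xc}(Q)$, where $\operatorname{xc}$ denotes the linear extension complexity and $P \times Q \subseteq \mathbb{R}^{d_P} \times \mathbb{R}^{d_Q}$ is the Cartesian product.
   Context: A polytope is the convex hull of finitely many points in some $\mathbb{R}^d$. The facets of a non-empty polytope are its non-empty faces of dimension one less than the dimension of the polytope; in particular a single point has no facets. For a non-empty polytope $P$, the linear extension complexity $\operatorname{xc}(P)$ is the smallest number of facets of any polytope (in a Euclidean space of any dimension) that can be affinely projected onto $P$, i.e. whose image under some affine map is $P$. A polytope $P \subseteq \mathbb{R}^d$ is called a pyramid with base $B \subseteq \mathbb{R}^d$ (a polytope) and apex $v \in \mathbb{R}^d$ if $P = \operatorname{conv}(B \cup \{v\})$ and $v$ is not contained in the affine hull of $B$. A polytope is a pyramid if it is a pyramid with some base and some apex. *)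

theory Defs
  imports "HOL-Analysis.Analysis" "HOL-Analysis.Finite_Function_Topology"
begin

text \<open>
  The definition of extension complexity quantifies over polytopes in Euclidean spaces of arbitrary
  dimension, so these spaces have to live in one type. The space of dimension n is represented
  by the finitely supported sequences that vanish from index n on. The library's notions
  \<^const>\<open>polytope\<close> and \<^const>\<open>face_of\<close> make sense in every real vector space; only
  \<^const>\<open>aff_dim\<close> and \<^const>\<open>facet_of\<close> are confined to the class of Euclidean spaces, so their
  definitions are repeated here for arbitrary real vector spaces.
\<close>

definition coord_space :: "nat \<Rightarrow> (nat, real) poly_mapping set" where
  "coord_space n = {x. Poly_Mapping.keys x \<subseteq> {..<n}}"

definition vs_aff_dim :: "'a::real_vector set \<Rightarrow> int" where
  "vs_aff_dim S = (SOME d :: int.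
     \<exists>B. affine hull B = affine hull S \<and> \<not> affine_dependent B \<and> of_nat (card B) = d + 1)"

definition vs_facet_of :: "'a::real_vector set \<Rightarrow> 'a set \<Rightarrow> bool" (infixr \<open>(vs'_facet'_of)\<close> 50) where
  "F vs_facet_of S \<longleftrightarrow> F face_of S \<and> F \<noteq> {} \<and> vs_aff_dim F = vs_aff_dim S - 1"

lemma vs_aff_dim_eq_aff_dim: "vs_aff_dim S = aff_dim S"
  by (simp add: vs_aff_dim_def aff_dim_def)

lemma vs_facet_of_iff_facet_of: "F vs_facet_of S \<longleftrightarrow> F facet_of S"
  by (simp add: vs_facet_of_def facet_of_def vs_aff_dim_eq_aff_dim)

lemma finite_vs_facets:
  fixes S :: "'a::real_vector set"
  assumes "polytope S"
  shows "finite {F. F vs_facet_of S}"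
proof -
  obtain V where V: "finite V" "S = convex hull V"
    using assms by (auto simp: polytope_def)
  have "F = convex hull (V \<inter> F)" if F: "F face_of S" for F
  proof
    have "convex F" using F by (simp add: face_of_def)
    then show "convex hull (V \<inter> F) \<subseteq> F" by (simp add: hull_minimal)
    show "F \<subseteq> convex hull (V \<inter> F)"
    proof
      fix x assume x: "x \<in> F"
      then have "x \<in> convex hull V" using F V(2) by (auto simp: face_of_def)
      then obtain u where u: "\<forall>v\<in>V. 0 \<le> u v" "sum u V = 1" "(\<Sum>v\<in>V. u v *\<^sub>R v) = x"
        by (auto simp: convex_hull_finite[OF V(1)])
      have VS: "V \<subseteq> S" using V(2) by (simp add: hull_subset)
      have zero: "u v = 0" if v: "v \<in> V" "v \<notin> F" for v
      proof (rule ccontr)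
        assume nz: "u v \<noteq> 0"
        then have pos: "0 < u v" using u(1) v(1) by force
        have s1: "u v + sum u (V - {v}) = 1" 
          using u(2) V(1) v(1) by (simp add: sum.remove)
        have s2: "u v *\<^sub>R v + (\<Sum>w\<in>V - {v}. u w *\<^sub>R w) = x"
          using u(3) V(1) v(1) by (simp add: sum.remove)
        have nn: "0 \<le> sum u (V - {v})" using u(1) by (intro sum_nonneg) auto
        show False
        proof (cases "sum u (V - {v}) = 0")
          case True
          then have "\<forall>w\<in>V - {v}. u w = 0"
            using u(1) V(1) by (subst (asm) sum_nonneg_eq_0_iff) auto
          then have "(\<Sum>w\<in>V - {v}. u w *\<^sub>R w) = 0" by (intro sum.neutral) auto
          then have "x = v" using s1 s2 True by simp
          then show False using x v by simp
        next
          case False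
          define t where "t = sum u (V - {v})"
          have t: "0 < t" "t < 1" "u v = 1 - t" using False nn pos s1 by (auto simp: t_def)
          define y where "y = (\<Sum>w\<in>V - {v}. (u w / t) *\<^sub>R w)"
          have ty: "t *\<^sub>R y = (\<Sum>w\<in>V - {v}. u w *\<^sub>R w)"
            using t by (simp add: y_def scaleR_right.sum)
          have yS: "y \<in> S"
            unfolding y_def V(2)
          proof (rule convex_sum)
            show "(\<Sum>w\<in>V - {v}. u w / t) = 1"
              using t by (simp flip: sum_divide_distrib t_def)
          qed (use V(1) u(1) t in \<open>auto simp: hull_inc\<close>)
          have xe: "x = (1 - t) *\<^sub>R v + t *\<^sub>R y" using s2 ty t by simp
          have "v \<noteq> y"
          proof
            assume "v = y"
            then have "x = v" using xe by (simp flip: scaleR_left_distrib)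
            then show False using x v by simp
          qed
          then have "x \<in> open_segment v y" using xe t by (auto simp: in_segment)
          moreover have "v \<in> S" using VS v by blast
          ultimately have "v \<in> F"
            using F x yS unfolding face_of_def by blast
          then show False using v by simp
        qed
      qed
      have "(\<Sum>v\<in>V \<inter> F. u v *\<^sub>R v) = x"
        using u(3) V(1) zero by (subst sum.mono_neutral_left[of V]) auto
      moreover have "sum u (V \<inter> F) = 1"
        using u(2) V(1) zero by (subst sum.mono_neutral_left[of V]) auto
      moreover have "finite (V \<inter> F)" "\<forall>v\<in>V \<inter> F. 0 \<le> u v" using V(1) u(1) by auto
      ultimately show "x \<in> convex hull (V \<inter> F)"
        unfolding convex_hull_finite[OF \<open>finite (V \<inter> F)\<close>] by blast
    qed
  qed
  then have "{F. F vs_facet_of S} \<subseteq> (\<lambda>W. convex hull W) ` Pow V"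
    unfolding vs_facet_of_def by blast
  then show ?thesis using V(1) by (meson finite_Pow_iff finite_imageI finite_subset)
qed

definition affine_map :: "('a::real_vector \<Rightarrow> 'b::real_vector) \<Rightarrow> bool" where
  "affine_map f \<longleftrightarrow> (\<exists>g c. linear g \<and> f = (\<lambda>x. g x + c))"

text \<open>
  An affine map defined only on \<^term>\<open>coord_space n\<close> extends to the whole type, so it
  is no restriction to take f total.
\<close>

definition xc :: "'a::real_vector set \<Rightarrow> nat" where
  "xc P = (LEAST k. \<exists>n E (f :: (nat, real) poly_mapping \<Rightarrow> 'a).
     polytope E \<and> E \<subseteq> coord_space n \<and> affine_map f \<and> f ` E = P \<and>
     card {F. F vs_facet_of E} = k)"

definition pyramid :: "'a::real_vector set \<Rightarrow> bool" where
  "pyramid P \<longleftrightarrow> (\<exists>B v. polytope B \<and> v \<notin> affine hull B \<and> P = convex hull (B \<union> {v}))"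

end

theory Submission
  imports Defs
begin

text \<open>
  By Yannakakis' theorem the extension complexity of a polytope \<open>P\<close> is the nonnegative rank of its
  slack matrix. This is used here in a form without a choice of facets or vertices: the rows are all
  affine functions that are nonnegative on \<open>P\<close> and vanish somewhere on \<open>P\<close> (\<open>tight_on\<close>), the columns
  are all points of \<open>P\<close>, and \<open>factorization P k\<close> says that this matrix is a sum of \<open>k\<close> nonnegative
  matrices of rank one. Requiring the rows to vanish somewhere makes a single point, which has no
  facets, have rank 0. Lemma \<open>xc_eq_Least_factorization\<close> identifies the two numbers.

  A tight function on \<open>P \<times> Q\<close> is the sum of a tight function on \<open>P\<close> and one on \<open>Q\<close>, so the rank of
  \<open>P \<times> Q\<close> is at most the sum of the ranks. For the converse (\<open>factorization_Times_split_apex\<close>) let \<open>P\<close> be a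
  pyramid with nonempty base \<open>B\<close> and apex \<open>v\<close>, and take a factorization \<open>T * U\<close> with \<open>k\<close> terms of the matrix of
  \<open>P \<times> Q\<close>. Let \<open>A\<close> be the set of terms that occur in the row of some tight \<open>f\<close> on \<open>P\<close> with \<open>f v = 0\<close>.
  By nonnegativity the terms in \<open>A\<close> vanish on the columns \<open>(v, q)\<close>. Hence \<open>Q\<close>, read off from the
  columns \<open>(v, q)\<close>, needs only the terms outside \<open>A\<close>. On the other hand \<open>P\<close>, read off from the columns
  \<open>(p, q)\<close> with \<open>q\<close> fixed, needs only the terms in \<open>A\<close> and one more for the function \<open>f0\<close> that is 1 at \<open>v\<close>
  and 0 on \<open>B\<close>. This is one term too many, and it is saved in one of two ways.

  \<^item> Some term \<open>j \<in> A\<close> occurs in the row of a tight \<open>g\<close> on \<open>Q\<close>. Choose \<open>q\<close> with \<open>g q = 0\<close>. Then term \<open>j\<close>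
    vanishes on all columns \<open>(p, q)\<close>, so \<open>P\<close> needs only the terms in \<open>A - {j}\<close> and \<open>f0\<close>.
  \<^item> No term in \<open>A\<close> occurs in a row coming from \<open>Q\<close>. The row of \<open>f0\<close> needs some term \<open>j \<notin> A\<close>, which
    vanishes on the columns \<open>(b, q)\<close> with \<open>b \<in> B\<close>. Reading off \<open>Q\<close> from these columns instead, the terms
    in \<open>A\<close> and \<open>j\<close> are all dispensable.

  That the rank is at most the number of facets of any extension (\<open>factorization_card_facets\<close>) holds because
  the nonnegative functions of minimal support on the vertices are the facet functions and generate all
  tight functions. Conversely (\<open>factorization_imp_extension\<close>) a factorization with \<open>k\<close> terms gives an extension
  that is the nonnegative part of an affine subspace of \<open>k\<close>-dimensional space; it is a polytope, with
  at most one facet for each coordinate. The spaces are arbitrary real vector spaces, so closedness and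
  separation come from Farkas' lemma and dimensions are counted by bases.
\<close>

section \<open>Affine functions and Farkas' lemma in real vector spaces\<close>

lemma affine_map_comb:
  assumes "affine_map f" "u + v = 1"
  shows "f (u *\<^sub>R x + v *\<^sub>R y) = u *\<^sub>R f x + v *\<^sub>R f y"
proof -
  obtain g c where g: "linear g" "f = (\<lambda>x. g x + c)"
    using assms(1) by (auto simp: affine_map_def)
  have "u *\<^sub>R c + v *\<^sub>R c = c" 
    using assms(2) by (metis scaleR_left_distrib scaleR_one)
  then show ?thesis
    using g by (simp add: linear_add linear_scale algebra_simps)
qed

lemma affine_map_linear: "linear g \<Longrightarrow> affine_map (\<lambda>x. g x + c)"
  by (auto simp: affine_map_def)

lemma affine_map_compose:
  assumes "affine_map f" "affine_map g"
  shows "affine_map (\<lambda>x. f (g x))"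
proof -
  obtain f' c where f: "linear f'" "f = (\<lambda>x. f' x + c)"
    using assms(1) by (auto simp: affine_map_def)
  obtain g' d where g: "linear g'" "g = (\<lambda>x. g' x + d)"
    using assms(2) by (auto simp: affine_map_def)
  have "linear (\<lambda>x. f' (g' x))" 
    using linear_compose[OF g(1) f(1)] by (simp add: o_def)
  moreover have "(\<lambda>x. f (g x)) = (\<lambda>x. f' (g' x) + (f' d + c))"
    using f g by (simp add: linear_add algebra_simps)
  ultimately show ?thesis by (simp add: affine_map_linear)
qed

lemma affine_map_diff_mult:
  fixes f g :: "'a::real_vector \<Rightarrow> real"
  assumes "affine_map f" "affine_map g"
  shows "affine_map (\<lambda>x. f x - t * g x)"
proof -
  obtain f' c where f: "linear f'" "f = (\<lambda>x. f' x + c)"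
    using assms(1) by (auto simp: affine_map_def)
  obtain g' d where g: "linear g'" "g = (\<lambda>x. g' x + d)"
    using assms(2) by (auto simp: affine_map_def)
  have "linear (\<lambda>x. f' x - t * g' x)"
    using f(1) g(1) by (auto simp: linear_iff algebra_simps)
  moreover have "(\<lambda>x. f x - t * g x) = (\<lambda>x. (f' x - t * g' x) + (c - t * d))"
    using f g by (auto simp: algebra_simps)
  ultimately show ?thesis by (simp add: affine_map_linear)
qed

lemma affine_map_const: "affine_map (\<lambda>x. c)"
  using affine_map_linear[OF linear_zero, of c] by simp

lemma affine_map_diff_const:
  fixes f :: "'a::real_vector \<Rightarrow> real"
  assumes "affine_map f"
  shows "affine_map (\<lambda>x. f x - m)"
  using affine_map_diff_mult[OF assms affine_map_const[of m], of 1] by simp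

lemma affine_map_nonneg_hull:
  fixes f :: "'a::real_vector \<Rightarrow> real"
  assumes "affine_map f" "\<forall>v\<in>V. 0 \<le> f v" "x \<in> convex hull V"
  shows "0 \<le> f x"
proof -
  have "convex {x. 0 \<le> f x}"
    by (auto intro!: convexI simp: affine_map_comb[OF assms(1)])
  then have "convex hull V \<subseteq> {x. 0 \<le> f x}"
    using assms(2) by (intro hull_minimal) auto
  then show ?thesis using assms(3) by auto
qed

lemma affine_map_le_hull:
  fixes f g :: "'a::real_vector \<Rightarrow> real"
  assumes "affine_map f" "affine_map g" "\<forall>v\<in>V. g v \<le> f v" "x \<in> convex hull V"
  shows "g x \<le> f x"
  using affine_map_nonneg_hull[OF affine_map_diff_mult[OF assms(1,2), of 1], of V x] assms(3,4)
  by simp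

lemma affine_map_eq_hull:
  fixes f g :: "'a::real_vector \<Rightarrow> real"
  assumes "affine_map f" "affine_map g" "\<forall>v\<in>V. f v = g v" "x \<in> convex hull V"
  shows "f x = g x"
  using affine_map_le_hull[OF assms(1,2), of V x] affine_map_le_hull[OF assms(2,1), of V x]
    assms(3,4) by (simp add: order_antisym)

lemma exists_separating_linear:
  fixes x :: "'a::real_vector"
  assumes "x \<notin> span S"
  obtains g :: "'a \<Rightarrow> real" where "linear g" "\<forall>s\<in>S. g s = 0" "g x = 1"
proof -
  obtain B where B: "B \<subseteq> S" "independent B" "S \<subseteq> span B"
    using maximal_independent_subset by blast
  have x: "x \<notin> span B" using assms B(1) span_mono by blast
  then have "independent (insert x B)" using B(2) by (simp add: independent_insertI)
  from linear_independent_extend[OF this, of "\<lambda>y. if y = x then 1 else 0 :: real"]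
  obtain g :: "'a \<Rightarrow> real" where g: "linear g" "\<forall>y\<in>insert x B. g y = (if y = x then 1 else 0)"
    by auto
  have "x \<notin> B" using x span_base by blast
  then have "g y = 0" if "y \<in> B" for y using g(2) that by auto
  then have "g s = 0" if "s \<in> span B" for s
    using linear_eq_0_on_span[OF g(1)] that by blast
  with B(3) g show thesis by (intro that[of g]) auto
qed

text \<open>
  Induction on the number of generators. If the functional \<open>g\<close> that separates
  \<open>b\<close> from the other generators is negative at the new generator \<open>a\<close>,
  everything is projected along \<open>a\<close> onto the kernel of \<open>g\<close>: each
  generator is only moved in direction \<open>a\<close>, by a nonnegative multiple, and
  \<open>b\<close> by a negative one, so a representation of the projected \<open>b\<close> would
  lift. A functional separating the projections therefore exists, and it vanishes at
  \<open>a\<close> after composition with the projection.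
\<close>

lemma farkas:
  fixes w :: "'i \<Rightarrow> 'a::real_vector"
  assumes "finite I" 
    and "\<nexists>u. (\<forall>i\<in>I. 0 \<le> u i) \<and> b = (\<Sum>i\<in>I. u i *\<^sub>R w i)"
  shows "\<exists>g :: 'a \<Rightarrow> real. linear g \<and> (\<forall>i\<in>I. 0 \<le> g (w i)) \<and> g b < 0"
  using assms
proof (induction I arbitrary: w b rule: finite_induct)
  case empty
  then have "- b \<notin> span {}" by auto
  then obtain g :: "'a \<Rightarrow> real" where "linear g" "g (- b) = 1"
    by (rule exists_separating_linear)
  then show ?case by (intro exI[of _ g]) (auto simp: linear_neg)
next
  case (insert j I)
  have "\<nexists>u. (\<forall>i\<in>I. 0 \<le> u i) \<and> b = (\<Sum>i\<in>I. u i *\<^sub>R w i)"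
  proof
    assume "\<exists>u. (\<forall>i\<in>I. 0 \<le> u i) \<and> b = (\<Sum>i\<in>I. u i *\<^sub>R w i)"
    then obtain u where u: "\<forall>i\<in>I. 0 \<le> u i" "b = (\<Sum>i\<in>I. u i *\<^sub>R w i)" by blast
    have "b = (\<Sum>i\<in>insert j I. (u(j := 0)) i *\<^sub>R w i)"
      using insert.hyps u(2) by (simp add: sum.insert) (intro sum.cong, auto)
    moreover have "\<forall>i\<in>insert j I. 0 \<le> (u(j := 0)) i" using u(1) by simp
    ultimately show False using insert.prems by blast
  qed
  from insert.IH[OF this] obtain g :: "'a \<Rightarrow> real"
    where g: "linear g" "\<forall>i\<in>I. 0 \<le> g (w i)" "g b < 0" by blast
  show ?case
  proof (cases "0 \<le> g (w j)")
    case True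
    then show ?thesis using g by auto
  next
    case False
    define a where "a = w j"
    have ga: "g a < 0" using False by (simp add: a_def)
    \<comment> \<open>the projection along \<open>a\<close> onto the kernel of \<open>g\<close>\<close>
    define \<pi> where "\<pi> x = x - (g x / g a) *\<^sub>R a" for x
    have lin: "linear \<pi>"
      using g(1) by (auto simp: \<pi>_def linear_iff algebra_simps add_divide_distrib)
    have "\<nexists>u. (\<forall>i\<in>I. 0 \<le> u i) \<and> \<pi> b = (\<Sum>i\<in>I. u i *\<^sub>R \<pi> (w i))"
    proof
      assume "\<exists>u. (\<forall>i\<in>I. 0 \<le> u i) \<and> \<pi> b = (\<Sum>i\<in>I. u i *\<^sub>R \<pi> (w i))"
      then obtain u where u: "\<forall>i\<in>I. 0 \<le> u i" "\<pi> b = (\<Sum>i\<in>I. u i *\<^sub>R \<pi> (w i))" by blast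
      \<comment> \<open>the coefficient that \<open>a\<close> receives when the representation is lifted\<close>
      define t where "t = g b / g a + (\<Sum>i\<in>I. u i * (- (g (w i) / g a)))"
      have "0 \<le> t"
        unfolding t_def using u(1) g ga
        by (intro add_nonneg_nonneg sum_nonneg mult_nonneg_nonneg)
           (auto simp: divide_nonpos_neg divide_nonneg_neg)
      moreover have "b = (\<Sum>i\<in>I. u i *\<^sub>R w i) + t *\<^sub>R a"
      proof -
        have "(\<Sum>i\<in>I. u i *\<^sub>R \<pi> (w i)) 
            = (\<Sum>i\<in>I. u i *\<^sub>R w i) + (\<Sum>i\<in>I. u i * (- (g (w i) / g a))) *\<^sub>R a"
          by (simp add: \<pi>_def scaleR_sum_left sum_subtractf scaleR_diff_right sum_negf)
        moreover have "b = \<pi> b + (g b / g a) *\<^sub>R a" by (simp add: \<pi>_def)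
        ultimately show ?thesis by (simp add: u(2) t_def scaleR_left_distrib add_ac)
      qed
      moreover have "(\<Sum>i\<in>insert j I. (u(j := t)) i *\<^sub>R w i) = t *\<^sub>R a + (\<Sum>i\<in>I. u i *\<^sub>R w i)"
        using insert.hyps by (simp add: a_def) (intro sum.cong, auto)
      ultimately have "b = (\<Sum>i\<in>insert j I. (u(j := t)) i *\<^sub>R w i)"
        "\<forall>i\<in>insert j I. 0 \<le> (u(j := t)) i" using u(1) by (auto simp: add.commute)
      then show False using insert.prems by blast
    qed
    from insert.IH[OF this] obtain h :: "'a \<Rightarrow> real"
      where h: "linear h" "\<forall>i\<in>I. 0 \<le> h (\<pi> (w i))" "h (\<pi> b) < 0" by blast
    have "\<pi> a = 0" using ga by (simp add: \<pi>_def)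
    then have "h (\<pi> a) = 0" using h(1) by (simp add: linear_0)
    moreover have "linear (\<lambda>x. h (\<pi> x))" using linear_compose[OF lin h(1)] by (simp add: o_def)
    ultimately show ?thesis using h by (intro exI[of _ "\<lambda>x. h (\<pi> x)"]) (auto simp: a_def)
  qed
qed

text \<open>
  Farkas' lemma in \<open>'a \<times> real\<close>, where the points of \<open>V\<close> are
  placed at height 1.
\<close>

lemma separating_affine_map:
  fixes V :: "'a::real_vector set"
  assumes "finite V" "x \<notin> convex hull V"
  obtains f :: "'a \<Rightarrow> real" where "affine_map f" "\<forall>v\<in>V. 0 \<le> f v" "f x < 0"
proof -
  have "\<nexists>u. (\<forall>v\<in>V. 0 \<le> u v) \<and> (x, 1::real) = (\<Sum>v\<in>V. u v *\<^sub>R (v, 1))"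
  proof
    assume "\<exists>u. (\<forall>v\<in>V. 0 \<le> u v) \<and> (x, 1::real) = (\<Sum>v\<in>V. u v *\<^sub>R (v, 1))"
    then obtain u where u: "\<forall>v\<in>V. 0 \<le> u v" "(x, 1::real) = (\<Sum>v\<in>V. u v *\<^sub>R (v, 1))" by blast
    have "x = (\<Sum>v\<in>V. u v *\<^sub>R v)" "1 = sum u V"
      using arg_cong[OF u(2), of fst] arg_cong[OF u(2), of snd]
      by (simp_all add: fst_sum snd_sum)
    then show False using assms u(1) by (auto simp: convex_hull_finite)
  qed
  from farkas[OF assms(1) this] obtain g :: "'a \<times> real \<Rightarrow> real"
    where g: "linear g" "\<forall>v\<in>V. 0 \<le> g (v, 1)" "g (x, 1) < 0" by blast
  have "linear (\<lambda>x. (x, 0::real))" by (auto simp: linear_iff)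
  then have "affine_map (\<lambda>x. g (x, 0) + g (0, 1))"
    using linear_compose[OF _ g(1)] by (intro affine_map_linear) (simp add: o_def)
  moreover have "g (x, 0) + g (0, 1) = g (x, 1)" for x
    by (simp flip: linear_add[OF g(1)])
  ultimately show thesis using g by (intro that[of "\<lambda>x. g (x, 0) + g (0, 1)"]) auto
qed

section \<open>Facets and minimal supports\<close>

text \<open>
  The dimension is chosen through an arbitrary affine basis. Every affine basis yields the value
  \<open>card C\<close>, because translating one of its points to the origin turns the others into
  a basis of the same linear span.
\<close>

lemma vs_aff_dim_eq_card:
  fixes S :: "'a::real_vector set"
  assumes "a \<in> S" "independent C" "finite C" "C \<subseteq> (\<lambda>x. x - a) ` S" "(\<lambda>x. x - a) ` S \<subseteq> span C"
  shows "vs_aff_dim S = int (card C)"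
proof -
  have span_shift: "span ((\<lambda>x. - a + x) ` S) = span C"
    using assms(4,5) by (metis (no_types, lifting) ext span_eq span_superset subset_trans uminus_add_conv_diff)
  have hull: "affine hull S = (+) a ` span C"
    using affine_hull_span_gen[of a S] assms(1) span_shift by (simp add: hull_inc)
  have "\<exists>d::int. \<exists>B. affine hull B = affine hull S \<and> \<not> affine_dependent B \<and> of_nat (card B) = d + 1"
  proof (intro exI conjI)
    define B where "B = insert a ((+) a ` C)"
    have im: "(\<lambda>x. - a + x) ` ((+) a ` C) = C" by (force simp: image_iff)
    have "0 \<notin> C" using assms(2) dependent_zero by blast
    then have a: "a \<notin> (+) a ` C" by auto
    show "affine hull B = affine hull S"
      unfolding B_def affine_hull_insert_span_gen im hull ..
    show "\<not> affine_dependent B"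
      unfolding B_def affine_dependent_iff_dependent[OF a] im by (rule assms(2))
    show "int (card B) = int (card C) + 1"
      using a assms(3) by (simp add: B_def card_image)
  qed
  from someI_ex[OF this] obtain B where B: "affine hull B = affine hull S" "\<not> affine_dependent B"
    "int (card B) = vs_aff_dim S + 1"
    by (auto simp: vs_aff_dim_def)
  have "B \<noteq> {}" using B(1) assms(1) by (metis affine_hull_eq_empty empty_iff)
  then obtain b where b: "b \<in> B" by blast
  define D where "D = (\<lambda>x. - b + x) ` (B - {b})"
  have indep: "independent D"
    using affine_dependent_iff_dependent2[OF b] B(2) by (simp add: D_def)
  have "b \<in> affine hull S" using B(1) b hull_inc by metis
  then have bC: "b - a \<in> span C" by (auto simp: hull)
  have "D \<subseteq> span C"
  proof
    fix y assume "y \<in> D"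
    then obtain x where x: "x \<in> B" "y = - b + x" by (auto simp: D_def)
    then have "x \<in> (+) a ` span C" using B(1) hull hull_inc[of x B affine] by simp
    then have "x - a \<in> span C" by auto
    from span_diff[OF this bC] show "y \<in> span C" by (simp add: x algebra_simps)
  qed
  have hullB: "affine hull B = (+) b ` span D"
    using affine_hull_span2[OF b] by (simp add: D_def)
  have aD: "a - b \<in> span D" using hullB B(1) assms(1) hull_inc[of a S affine] by auto
  have "C \<subseteq> span D"
  proof
    fix y assume "y \<in> C"
    then have "a + y \<in> affine hull B" using B(1) hull by (auto simp: span_base)
    then have "a + y - b \<in> span D" using hullB by auto
    from span_diff[OF this aD] show "y \<in> span D" by (simp add: algebra_simps)
  qed
  have "finite D \<and> card D \<le> card C"
    using independent_span_bound[OF assms(3) indep \<open>D \<subseteq> span C\<close>] .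
  moreover have "card C \<le> card D"
    using independent_span_bound[OF _ assms(2) \<open>C \<subseteq> span D\<close>] calculation by blast
  ultimately have "card D = card C" "finite D" by auto
  moreover have "card D = card (B - {b})" by (simp add: D_def card_image)
  moreover have "finite (B - {b})"
    using \<open>finite D\<close> by (auto simp: D_def dest: finite_imageD)
  ultimately have "card B = card C + 1" using b
    by (metis Suc_eq_plus1 card.remove finite.insertI finite_Diff_insert finite_Diff2 finite.emptyI)
  then show ?thesis using B(3) by simp
qed

lemma face_of_nonneg_zero_set:
  fixes f :: "'a::real_vector \<Rightarrow> real"
  assumes "affine_map f" "convex S" "\<forall>x\<in>S. 0 \<le> f x"
  shows "{x \<in> S. f x = 0} face_of S"
  unfolding face_of_def
proof (intro conjI ballI impI)
  show "convex {x \<in> S. f x = 0}"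
    using assms(2) by (auto simp: convex_def affine_map_comb[OF assms(1)])
  fix a b x assume ab: "a \<in> S" "b \<in> S" "x \<in> {x \<in> S. f x = 0}" "x \<in> open_segment a b"
  then obtain t where t: "0 < t" "t < 1" "x = (1 - t) *\<^sub>R a + t *\<^sub>R b"
    by (auto simp: in_segment)
  have "f x = (1 - t) * f a + t * f b" using t by (simp add: affine_map_comb[OF assms(1)])
  with ab have "(1 - t) * f a + t * f b = 0" by simp
  moreover have "0 \<le> (1 - t) * f a" "0 \<le> t * f b" using assms(3) ab t by auto
  ultimately have "(1 - t) * f a = 0" "t * f b = 0" by linarith+
  then show "a \<in> {x \<in> S. f x = 0}" "b \<in> {x \<in> S. f x = 0}" using t ab by auto
qed auto

lemma span_shifted_hull:
  assumes "x \<in> convex hull V"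
  shows "x - a \<in> span ((\<lambda>x. x - a) ` V)"
proof -
  let ?S = "{x. x - a \<in> span ((\<lambda>x. x - a) ` V)}"
  have "convex ?S"
  proof (rule convexI)
    fix x y and u v :: real
    assume xy: "x \<in> ?S" "y \<in> ?S" and uv: "u + v = 1"
    have "u *\<^sub>R a + v *\<^sub>R a = a" using uv by (metis scaleR_left_distrib scaleR_one)
    then have "u *\<^sub>R x + v *\<^sub>R y - a = u *\<^sub>R (x - a) + v *\<^sub>R (y - a)"
      by (simp add: algebra_simps)
    with xy show "u *\<^sub>R x + v *\<^sub>R y \<in> ?S" by (simp add: span_add span_scale)
  qed
  then have "convex hull V \<subseteq> ?S" by (intro hull_minimal) (auto simp: span_base)
  with assms show ?thesis by auto
qed

text \<open>
  Minimality says that, up to scaling, \<open>f\<close> is the only affine function that vanishes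
  on the face \<open>f = 0\<close>. If that face had codimension larger than one, there would be a
  nonzero function vanishing on it and at \<open>v1\<close>, and this is not a multiple of
  \<open>f\<close>.
\<close>

lemma minimal_support_imp_facet:
  fixes f :: "'a::real_vector \<Rightarrow> real"
  assumes V: "finite V" and f: "affine_map f" "\<forall>v\<in>V. 0 \<le> f v"
    and v0: "v0 \<in> V" "f v0 = 0" and v1: "v1 \<in> V" "f v1 \<noteq> 0"
    and minimal: "\<And>g. affine_map g \<Longrightarrow> \<forall>v\<in>V. f v = 0 \<longrightarrow> g v = 0 \<Longrightarrow> \<exists>c. \<forall>v\<in>V. g v = c * f v"
  shows "{x \<in> convex hull V. f x = 0} vs_facet_of (convex hull V)"
proof -
  let ?E = "convex hull V" and ?F = "{x \<in> convex hull V. f x = 0}"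
  let ?s = "\<lambda>x. x - v0"
  have V_E: "V \<subseteq> ?E" by (rule hull_subset)
  have face: "?F face_of ?E"
    using face_of_nonneg_zero_set[OF f(1) convex_convex_hull] affine_map_nonneg_hull[OF f] by blast
  obtain C where C: "C \<subseteq> ?s ` ?F" "independent C" "?s ` ?F \<subseteq> span C"
    using maximal_independent_subset by blast
  have "?s ` ?E \<subseteq> span (?s ` V)" using span_shifted_hull by blast
  then have "finite C"
    using independent_span_bound[of "?s ` V" C] V C(1,2) by blast
  have v0F: "v0 \<in> ?F" using v0 V_E by auto
  obtain g c where g: "linear g" "f = (\<lambda>x. g x + c)"
    using f(1) by (auto simp: affine_map_def)
  have "g y = 0" if "y \<in> C" for y
    using C(1) that g v0 by (auto simp: linear_diff)
  then have "\<forall>y\<in>span C. g y = 0" using linear_eq_0_on_span[OF g(1)] by blast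
  moreover have "g (v1 - v0) \<noteq> 0" using v0 v1 g by (auto simp: linear_diff)
  ultimately have v1C: "v1 - v0 \<notin> span C" by blast
  let ?C = "insert (v1 - v0) C"
  have ind: "independent ?C" using C(2) v1C by (simp add: independent_insertI)
  have sp: "?s ` ?E \<subseteq> span ?C"
  proof (rule ccontr)
    assume "\<not> ?s ` ?E \<subseteq> span ?C"
    then obtain e where e: "e \<in> ?E" "e - v0 \<notin> span ?C" by blast
    obtain h :: "'a \<Rightarrow> real" where h: "linear h" "\<forall>y\<in>?C. h y = 0" "h (e - v0) = 1"
      using exists_separating_linear[OF e(2)] by blast
    have hC: "h y = 0" if "y \<in> span C" for y
      using linear_eq_0_on_span[OF h(1), of C y] h(2) that by blast
    have aff: "affine_map (\<lambda>x. h x - h v0)" using affine_map_linear[OF h(1), of "- h v0"] by simp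
    have hF: "h x - h v0 = 0" if "x \<in> ?F" for x
      using hC[of "x - v0"] C(3) that h(1) by (auto simp: linear_diff)
    have "\<forall>v\<in>V. f v = 0 \<longrightarrow> h v - h v0 = 0"
      using hF V_E by blast
    from minimal[OF aff this] obtain d where d: "\<forall>v\<in>V. h v - h v0 = d * f v" by blast
    have "h v1 - h v0 = 0" using h by (auto simp: linear_diff)
    with d v1 have "d = 0" by auto
    then have "\<forall>v\<in>V. h v - h v0 = 0" using d by simp
    then have "h e - h v0 = 0" using affine_map_eq_hull[OF aff affine_map_const] e(1) by blast
    then show False using h by (simp add: linear_diff)
  qed
  have "vs_aff_dim ?F = int (card C)"
    using vs_aff_dim_eq_card[OF v0F C(2) \<open>finite C\<close> C(1,3)] .
  moreover have "vs_aff_dim ?E = int (card ?C)"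
    using vs_aff_dim_eq_card[of v0 ?E ?C] v0F ind \<open>finite C\<close> C(1) v1 V_E sp by auto
  moreover have "card ?C = card C + 1"
    using v1C span_base \<open>finite C\<close> by (metis Suc_eq_plus1 card_insert_disjoint)
  ultimately have "vs_aff_dim ?F = vs_aff_dim ?E - 1" by linarith
  then show ?thesis using face v0F unfolding vs_facet_of_def by blast
qed

text \<open>
  The ratio test: \<open>t\<close> is the smallest ratio \<open>f v / g v\<close> over all
  \<open>v\<close> with \<open>g v > 0\<close>. It is used to shrink the support of a nonnegative
  vector while staying in a given subspace.
\<close>

lemma subtract_until_zero:
  fixes f g :: "'v \<Rightarrow> real"
  assumes "finite V" "\<forall>v\<in>V. 0 \<le> f v" "\<exists>v\<in>V. 0 < g v" "\<forall>v\<in>V. f v = 0 \<longrightarrow> g v = 0"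
  obtains t v where "0 < t" "\<forall>v\<in>V. 0 \<le> f v - t * g v" "v \<in> V" "0 < f v" "f v - t * g v = 0"
proof -
  define R where "R = (\<lambda>v. f v / g v) ` {v \<in> V. 0 < g v}"
  have "finite R" "R \<noteq> {}" using assms by (auto simp: R_def)
  then have "Min R \<in> R" by (rule Min_in)
  then obtain v where v: "v \<in> V" "0 < g v" "Min R = f v / g v" by (auto simp: R_def)
  have fv: "0 < f v" using v assms(2,4) by (metis less_eq_real_def less_irrefl)
  have "0 \<le> f w - Min R * g w" if w: "w \<in> V" for w
  proof (cases "0 < g w")
    case True
    then have "Min R \<le> f w / g w" using w \<open>finite R\<close> by (intro Min_le) (auto simp: R_def)
    then show ?thesis using True by (simp add: field_simps)
  next
    case False
    moreover have "0 < Min R" using v fv by simp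
    ultimately have "Min R * g w \<le> 0" by (simp add: mult_nonneg_nonpos)
    then show ?thesis using assms(2) w by force
  qed
  then show thesis using that[of "Min R" v] v fv by auto
qed

text \<open>
  The facet functions generate the cone of tight functions, by induction on the size of the
  support on the vertices. If the support of \<open>f\<close> is minimal, then \<open>f\<close> is
  a multiple of the function chosen for its facet. Otherwise another function \<open>g\<close>
  with zeros wherever \<open>f\<close> has them can be subtracted until a further zero appears,
  giving \<open>f1\<close>; and then \<open>f1\<close> can be subtracted from \<open>f\<close> in
  the same way, which exhibits \<open>f\<close> as a nonnegative combination of two functions of
  smaller support. Any choice \<open>a F\<close> of a function cutting out \<open>F\<close> will
  do.
\<close>

lemma tight_eq_sum_of_facets:
  fixes V :: "'a::real_vector set" and f :: "'a \<Rightarrow> real"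
  defines "E \<equiv> convex hull V"
  assumes V: "finite V"
    and a: "\<And>F (f :: 'a \<Rightarrow> real). F vs_facet_of E \<Longrightarrow> affine_map f \<Longrightarrow> \<forall>v\<in>V. 0 \<le> f v \<Longrightarrow> {x \<in> E. f x = 0} = F \<Longrightarrow>
       affine_map (a F) \<and> (\<forall>x\<in>E. 0 \<le> a F x) \<and> {x \<in> E. a F x = 0} = F"
    and f: "affine_map f" "\<forall>v\<in>V. 0 \<le> f v" "\<exists>v\<in>V. f v = 0"
  shows "\<exists>T. (\<forall>F. 0 \<le> T F) \<and> (\<forall>x\<in>E. f x = (\<Sum>F | F vs_facet_of E. T F * a F x))"
  using f
proof (induction "card {v\<in>V. 0 < f v}" arbitrary: f rule: less_induct)
  case less
  have finV: "finite {v\<in>V. P v}" for P using V by simp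
  have V_E: "V \<subseteq> E" unfolding E_def by (rule hull_subset)
  have smaller: "\<exists>T. (\<forall>F. 0 \<le> T F) \<and> (\<forall>x\<in>E. f x - t * g x = (\<Sum>F | F vs_facet_of E. T F * a F x))"
    if "affine_map g" "\<forall>v\<in>V. f v = 0 \<longrightarrow> g v = 0" "\<forall>v\<in>V. 0 \<le> f v - t * g v"
      "v \<in> V" "0 < f v" "f v - t * g v = 0" for g t v
  proof (rule less.hyps)
    show "card {v \<in> V. 0 < f v - t * g v} < card {v \<in> V. 0 < f v}"
    proof (rule psubset_card_mono)
      have "0 < f w" if "w \<in> V" "0 < f w - t * g w" for w
      proof (cases "f w = 0")
        case True
        then have "g w = 0" using that(1) \<open>\<forall>v\<in>V. f v = 0 \<longrightarrow> g v = 0\<close> by blast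
        then show ?thesis using that(2) True by (metis mult_zero_right diff_zero)
      next
        case False
        with that less.prems(2) show ?thesis by force
      qed
      then have "{v \<in> V. 0 < f v - t * g v} \<subseteq> {v \<in> V. 0 < f v}" by blast
      moreover have "v \<in> {v \<in> V. 0 < f v} - {v \<in> V. 0 < f v - t * g v}" using that by auto
      ultimately show "{v \<in> V. 0 < f v - t * g v} \<subset> {v \<in> V. 0 < f v}" by blast
    qed (rule finV)
    show "affine_map (\<lambda>x. f x - t * g x)"
      using affine_map_diff_mult[OF less.prems(1) that(1)] .
    show "\<exists>v\<in>V. f v - t * g v = 0" using that by blast
  qed (use that in blast)
  show ?case
  proof (cases "\<forall>v\<in>V. f v = 0")
    case True
    have "f x = 0" if "x \<in> E" for x
      using affine_map_eq_hull[OF less.prems(1) affine_map_const True] that by (simp add: E_def)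
    then show ?thesis by (intro exI[of _ "\<lambda>_. 0"]) simp
  next
    case False
    then obtain v1 where v1: "v1 \<in> V" "f v1 \<noteq> 0" by blast
    obtain v0 where v0: "v0 \<in> V" "f v0 = 0" using less.prems(3) by blast
    show ?thesis
    proof (cases "\<forall>g. affine_map g \<longrightarrow> (\<forall>v\<in>V. f v = 0 \<longrightarrow> g v = 0) \<longrightarrow> (\<exists>c. \<forall>v\<in>V. g v = c * f v)")
      case True
      define F where "F = {x \<in> E. f x = 0}"
      have F: "F vs_facet_of E"
        unfolding F_def E_def
        by (rule minimal_support_imp_facet[OF V less.prems(1,2) v0 v1]) (use True in blast)
      have aF: "affine_map (a F)" "\<forall>x\<in>E. 0 \<le> a F x" "{x \<in> E. a F x = 0} = F"
        using a[OF F less.prems(1,2)] by (auto simp: F_def)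
      then have "\<forall>v\<in>V. f v = 0 \<longrightarrow> a F v = 0" using V_E by (auto simp: F_def)
      then obtain c where c: "\<forall>v\<in>V. a F v = c * f v" using True aF(1) by blast
      have "a F v1 \<noteq> 0" using aF(3) v1 V_E by (auto simp: F_def)
      then have "0 < a F v1" using aF(2) v1 V_E by (metis less_eq_real_def subsetD)
      moreover have "0 < f v1" using v1 less.prems(2) by force
      ultimately have "0 < c" using c v1 by (metis zero_less_mult_pos2)
      have "f x = (1 / c) * a F x" if "x \<in> E" for x
      proof -
        have "\<forall>v\<in>V. c * f v = a F v" using c by simp
        moreover have "affine_map (\<lambda>x. c * f x)"
          using affine_map_diff_mult[OF affine_map_const[of 0] less.prems(1), of "- c"] by simp
        ultimately have "c * f x = a F x"
          using affine_map_eq_hull[OF _ aF(1)] that by (simp add: E_def)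
        then show ?thesis using \<open>0 < c\<close> by (simp add: field_simps)
      qed
      moreover have "finite {F. F vs_facet_of E}"
        by (rule finite_vs_facets) (use V in \<open>auto simp: E_def polytope_def\<close>)
      ultimately show ?thesis
        using F \<open>0 < c\<close> by (intro exI[of _ "\<lambda>G. if G = F then 1 / c else 0"]) (auto simp: if_distrib if_distribR sum.delta cong: if_cong)
    next
      case False
      then obtain g where g: "affine_map g" "\<forall>v\<in>V. f v = 0 \<longrightarrow> g v = 0" 
        "\<nexists>c. \<forall>v\<in>V. g v = c * f v" by blast
      have "\<exists>g. affine_map g \<and> (\<forall>v\<in>V. f v = 0 \<longrightarrow> g v = 0) \<and> (\<nexists>c. \<forall>v\<in>V. g v = c * f v) \<and> (\<exists>v\<in>V. 0 < g v)"
      proof (cases "\<exists>v\<in>V. 0 < g v")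
        case True
        then show ?thesis using g by blast
      next
        case False
        have "\<exists>v\<in>V. g v \<noteq> 0" using g(3) by (metis mult_zero_left)
        then have "\<exists>v\<in>V. 0 < - g v" using False by (metis linorder_neqE_linordered_idom neg_0_less_iff_less)
        moreover have "affine_map (\<lambda>x. - g x)"
          using affine_map_diff_mult[OF affine_map_const[of 0] g(1), of 1] by simp
        moreover have "\<nexists>c. \<forall>v\<in>V. - g v = c * f v"
          using g(3) by (metis minus_equation_iff mult_minus_left)
        ultimately show ?thesis using g by (intro exI[of _ "\<lambda>x. - g x"]) auto
      qed
      then obtain g where g: "affine_map g" "\<forall>v\<in>V. f v = 0 \<longrightarrow> g v = 0" 
        "\<nexists>c. \<forall>v\<in>V. g v = c * f v" "\<exists>v\<in>V. 0 < g v" by blast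
      obtain t v where t: "0 < t" "\<forall>v\<in>V. 0 \<le> f v - t * g v" "v \<in> V" "0 < f v" "f v - t * g v = 0"
        using subtract_until_zero[OF V less.prems(2) g(4,2)] .
      define f1 where "f1 x = f x - t * g x" for x
      have f1: "affine_map f1" unfolding f1_def using affine_map_diff_mult[OF less.prems(1) g(1)] .
      have f1_0: "\<forall>v\<in>V. f v = 0 \<longrightarrow> f1 v = 0" using g(2) by (simp add: f1_def)
      have "\<exists>v\<in>V. f1 v \<noteq> 0"
      proof (rule ccontr)
        assume "\<not> (\<exists>v\<in>V. f1 v \<noteq> 0)"
        then have "\<forall>v\<in>V. g v = (1 / t) * f v" using t(1) by (auto simp: f1_def field_simps)
        then show False using g(3) by blast
      qed
      then have f1_pos: "\<exists>v\<in>V. 0 < f1 v" using t(2) by (auto simp: f1_def less_eq_real_def)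
      obtain s w where s: "0 < s" "\<forall>v\<in>V. 0 \<le> f v - s * f1 v" "w \<in> V" "0 < f w" "f w - s * f1 w = 0"
        using subtract_until_zero[OF V less.prems(2) f1_pos f1_0] .
      obtain T1 where T1: "\<forall>F. 0 \<le> T1 F" "\<forall>x\<in>E. f1 x = (\<Sum>F | F vs_facet_of E. T1 F * a F x)"
        using smaller[OF g(1,2) t(2-5)] unfolding f1_def by blast
      obtain T2 where T2: "\<forall>F. 0 \<le> T2 F" 
        "\<forall>x\<in>E. f x - s * f1 x = (\<Sum>F | F vs_facet_of E. T2 F * a F x)"
        using smaller[OF f1 f1_0 s(2-5)] by blast
      have "f x = (\<Sum>F | F vs_facet_of E. (s * T1 F + T2 F) * a F x)" if "x \<in> E" for x
      proof -
        have "f x = s * f1 x + (f x - s * f1 x)" by simp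
        also have "\<dots> = (\<Sum>F | F vs_facet_of E. (s * T1 F + T2 F) * a F x)"
          using T1(2) T2(2) that by (simp add: sum_distrib_left sum.distrib algebra_simps)
        finally show ?thesis .
      qed
      then show ?thesis using T1(1) T2(1) s(1)
        by (intro exI[of _ "\<lambda>F. s * T1 F + T2 F"]) auto
    qed
  qed
qed

section \<open>Nonnegative factorizations of the slack matrix\<close>

definition tight_on :: "'a::real_vector set \<Rightarrow> ('a \<Rightarrow> real) \<Rightarrow> bool" where
  "tight_on P f \<longleftrightarrow> affine_map f \<and> (\<forall>p\<in>P. 0 \<le> f p) \<and> (\<exists>p\<in>P. f p = 0)"

text \<open>
  \<open>U p i\<close> and \<open>T f i\<close> are the entries of the two factors of the slack
  matrix; the inner dimension is \<open>k\<close>.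
\<close>

definition factorization :: "'a::real_vector set \<Rightarrow> nat \<Rightarrow> bool" where
  "factorization P k \<longleftrightarrow> (\<exists>(U :: 'a \<Rightarrow> nat \<Rightarrow> real) T.
     (\<forall>p\<in>P. \<forall>i<k. 0 \<le> U p i) \<and>
     (\<forall>f. tight_on P f \<longrightarrow> (\<forall>i<k. 0 \<le> T f i) \<and> (\<forall>p\<in>P. f p = (\<Sum>i<k. T f i * U p i))))"

text \<open>
  Any finite index set may be used for the terms, and the rows may be treated separately.
\<close>

lemma factorizationI:
  fixes U :: "'a::real_vector \<Rightarrow> 'i \<Rightarrow> real"
  assumes "finite I" and U: "\<And>p i. p \<in> P \<Longrightarrow> i \<in> I \<Longrightarrow> 0 \<le> U p i"
    and T: "\<And>f. tight_on P f \<Longrightarrow> \<exists>T. (\<forall>i\<in>I. 0 \<le> T i) \<and> (\<forall>p\<in>P. f p = (\<Sum>i\<in>I. T i * U p i))"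
  shows "factorization P (card I)"
proof -
  obtain h where h: "bij_betw h {..<card I} I"
    using ex_bij_betw_nat_finite[OF assms(1)] by (auto simp: atLeast0LessThan)
  then have hI: "h i \<in> I" if "i < card I" for i using that by (auto simp: bij_betw_def)
  have "\<forall>f. \<exists>T. tight_on P f \<longrightarrow> (\<forall>i\<in>I. 0 \<le> T i) \<and> (\<forall>p\<in>P. f p = (\<Sum>i\<in>I. T i * U p i))"
    using T by blast
  from choice[OF this] obtain T where T:
    "\<forall>f. tight_on P f \<longrightarrow> (\<forall>i\<in>I. 0 \<le> T f i) \<and> (\<forall>p\<in>P. f p = (\<Sum>i\<in>I. T f i * U p i))" ..
  have "(\<Sum>i<card I. T f (h i) * U p (h i)) = (\<Sum>i\<in>I. T f i * U p i)" for f p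
    by (rule sum.reindex_bij_betw[OF h])
  then show ?thesis
    unfolding factorization_def using U T hI
    by (intro exI[of _ "\<lambda>p i. U p (h i)"] exI[of _ "\<lambda>f i. T f (h i)"]) auto
qed

lemma tight_on_hullI:
  fixes h :: "'a::real_vector \<Rightarrow> real"
  assumes "finite V" "V \<noteq> {}" "affine_map h"
  defines "m \<equiv> Min (h ` V)"
  shows "tight_on (convex hull V) (\<lambda>x. h x - m)"
proof -
  have aff: "affine_map (\<lambda>x. h x - m)" using affine_map_diff_const[OF assms(3)] .
  have "\<forall>v\<in>V. 0 \<le> h v - m" using assms by (simp add: m_def)
  then have "\<forall>x\<in>convex hull V. 0 \<le> h x - m" using affine_map_nonneg_hull[OF aff] by blast
  moreover have "m \<in> h ` V" using assms by (simp add: m_def)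
  then have "\<exists>x\<in>convex hull V. h x - m = 0" by (auto intro: hull_inc)
  ultimately show ?thesis using aff by (simp add: tight_on_def)
qed

lemma tight_on_hullD:
  fixes f :: "'a::real_vector \<Rightarrow> real"
  assumes "finite V" "tight_on (convex hull V) f"
  shows "\<forall>v\<in>V. 0 \<le> f v" "\<exists>v\<in>V. f v = 0"
proof -
  show nn: "\<forall>v\<in>V. 0 \<le> f v" using assms(2) by (auto simp: tight_on_def hull_inc)
  obtain p where p: "p \<in> convex hull V" "f p = 0" using assms(2) by (auto simp: tight_on_def)
  then have "V \<noteq> {}" by auto
  then have "Min (f ` V) \<in> f ` V" using assms(1) by simp
  then obtain v where v: "v \<in> V" "f v = Min (f ` V)" by auto
  have "f v \<le> f p"
    using affine_map_le_hull[of f "\<lambda>_. f v" V p] assms p v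
    by (auto simp: tight_on_def affine_map_const)
  moreover have "0 \<le> f v" using nn v(1) by blast
  ultimately have "f v = 0" using p(2) by linarith
  then show "\<exists>v\<in>V. f v = 0" using v by blast
qed

lemma factorization_card_facets:
  assumes "polytope E"
  shows "factorization E (card {F. F vs_facet_of E})"
proof -
  obtain V where V: "finite V" "E = convex hull V"
    using assms by (auto simp: polytope_def)
  define good where "good F a \<longleftrightarrow> affine_map a \<and> (\<forall>x\<in>E. 0 \<le> a x) \<and> {x \<in> E. a x = 0} = F"
    for F and a :: "'a \<Rightarrow> real"
  \<comment> \<open>the value 0 for facets without a function keeps \<open>a\<close> nonnegative\<close>
  define a where "a F = (if \<exists>a. good F a then SOME a. good F a else (\<lambda>_. 0))" for F
  have a: "good F (a F)" if "good F f" for F f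
    using that someI[of "good F" f] by (auto simp: a_def)
  show ?thesis
  proof (rule factorizationI[where U = "\<lambda>x F. a F x"])
    show "0 \<le> a F p" if "p \<in> E" for p F
    proof (cases "\<exists>f. good F f")
      case True
      then show ?thesis using a that unfolding good_def by blast
    qed (simp add: a_def)
    fix f assume f: "tight_on E f"
    have "\<exists>T. (\<forall>F. 0 \<le> T F) \<and> (\<forall>x\<in>convex hull V. f x = (\<Sum>F | F vs_facet_of convex hull V. T F * a F x))"
    proof (rule tight_eq_sum_of_facets[OF V(1)])
      fix F and h :: "'a \<Rightarrow> real"
      assume h: "affine_map h" "\<forall>v\<in>V. 0 \<le> h v" "{x \<in> convex hull V. h x = 0} = F"
      have "good F h" using h affine_map_nonneg_hull[OF h(1,2)] by (simp add: good_def V(2))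
      from a[OF this] show "affine_map (a F) \<and> (\<forall>x\<in>convex hull V. 0 \<le> a F x) \<and> {x \<in> convex hull V. a F x = 0} = F"
        by (simp add: good_def V(2))
    next
      show "affine_map f" "\<forall>v\<in>V. 0 \<le> f v" "\<exists>v\<in>V. f v = 0"
        using tight_on_hullD[OF V(1)] f by (auto simp: V(2) tight_on_def)
    qed
    then show "\<exists>T. (\<forall>F\<in>{F. F vs_facet_of E}. 0 \<le> T F) \<and> (\<forall>x\<in>E. f x = (\<Sum>F | F vs_facet_of E. T F * a F x))"
      by (auto simp: V(2))
  qed (rule finite_vs_facets[OF assms])
qed

lemma factorization_image:
  assumes "factorization E k" "affine_map \<phi>"
  shows "factorization (\<phi> ` E) k"
proof -
  obtain U T where U: "\<forall>p\<in>E. \<forall>i<k. 0 \<le> (U p i :: real)"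
    and T: "\<forall>f. tight_on E f \<longrightarrow> (\<forall>i<k. 0 \<le> T f i) \<and> (\<forall>p\<in>E. f p = (\<Sum>i<k. T f i * U p i))"
    using assms(1) unfolding factorization_def by blast
  have s: "inv_into E \<phi> p \<in> E" "\<phi> (inv_into E \<phi> p) = p" if "p \<in> \<phi> ` E" for p
    using that by (simp_all add: inv_into_into f_inv_into_f)
  have "factorization (\<phi> ` E) (card {..<k})"
  proof (rule factorizationI[where U = "\<lambda>p. U (inv_into E \<phi> p)"])
    fix f :: "'b \<Rightarrow> real" assume f: "tight_on (\<phi> ` E) f"
    then have "tight_on E (\<lambda>x. f (\<phi> x))"
      using affine_map_compose[OF _ assms(2)] by (auto simp: tight_on_def)
    with T have "\<forall>i<k. 0 \<le> T (\<lambda>x. f (\<phi> x)) i" 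
      "\<forall>p\<in>E. f (\<phi> p) = (\<Sum>i<k. T (\<lambda>x. f (\<phi> x)) i * U p i)" by blast+
    then show "\<exists>T. (\<forall>i\<in>{..<k}. 0 \<le> T i) \<and> (\<forall>p\<in>\<phi> ` E. f p = (\<Sum>i<k. T i * U (inv_into E \<phi> p) i))"
      using s by (intro exI[of _ "T (\<lambda>x. f (\<phi> x))"]) (metis lessThan_iff)
  qed (use s U in auto)
  then show ?thesis by simp
qed

lemma affine_map_fst: "affine_map f \<Longrightarrow> affine_map (\<lambda>z. f (fst z))"
  using affine_map_compose[OF _ affine_map_linear[OF linear_fst, of 0]] by simp

lemma affine_map_snd: "affine_map f \<Longrightarrow> affine_map (\<lambda>z. f (snd z))"
  using affine_map_compose[OF _ affine_map_linear[OF linear_snd, of 0]] by simp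

text \<open>
  If \<open>h\<close> vanishes at \<open>(p0, q0)\<close>, then \<open>h (p, q) = h (p, q0) + h
  (p0, q)\<close>, and both summands are tight because they vanish at \<open>p0\<close> and
  \<open>q0\<close>. So the terms of the two factorizations can be put side by side.
\<close>

lemma factorization_Times:
  assumes "factorization P k" "factorization Q l"
  shows "factorization (P \<times> Q) (k + l)"
proof -
  obtain U T where U: "\<forall>p\<in>P. \<forall>i<k. 0 \<le> (U p i :: real)"
    and T: "\<forall>f. tight_on P f \<longrightarrow> (\<forall>i<k. 0 \<le> T f i) \<and> (\<forall>p\<in>P. f p = (\<Sum>i<k. T f i * U p i))"
    using assms(1) unfolding factorization_def by blast
  obtain U' T' where U': "\<forall>p\<in>Q. \<forall>i<l. 0 \<le> (U' p i :: real)"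
    and T': "\<forall>f. tight_on Q f \<longrightarrow> (\<forall>i<l. 0 \<le> T' f i) \<and> (\<forall>p\<in>Q. f p = (\<Sum>i<l. T' f i * U' p i))"
    using assms(2) unfolding factorization_def by blast
  let ?I = "{..<k} <+> {..<l}"
  let ?U = "\<lambda>z. case_sum (U (fst z)) (U' (snd z))"
  have "factorization (P \<times> Q) (card ?I)"
  proof (rule factorizationI[where U = ?U])
    fix h :: "'a \<times> 'b \<Rightarrow> real" assume h: "tight_on (P \<times> Q) h"
    then have aff: "affine_map h" by (simp add: tight_on_def)
    then obtain g c where g: "linear g" "h = (\<lambda>x. g x + c)"
      by (auto simp: affine_map_def)
    obtain p0 q0 where pq: "p0 \<in> P" "q0 \<in> Q" "h (p0, q0) = 0" using h by (auto simp: tight_on_def)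
    let ?f = "\<lambda>p. h (p, q0)" and ?g = "\<lambda>q. h (p0, q)"
    have lin: "linear (\<lambda>p. (p, 0))" "linear (\<lambda>q. (0, q))" by (auto simp: linear_iff)
    have affs: "affine_map (\<lambda>p. (p, q0))" "affine_map (\<lambda>q. (p0, q))"
      using affine_map_linear[OF lin(1), of "(0, q0)"] affine_map_linear[OF lin(2), of "(p0, 0)"]
      by simp_all
    have f: "tight_on P ?f" and g': "tight_on Q ?g"
      using h pq affine_map_compose[OF aff affs(1)] affine_map_compose[OF aff affs(2)]
      by (auto simp: tight_on_def)
    have split: "h (p, q) = ?f p + ?g q" for p q
    proof -
      have "g (p, q) + g (p0, q0) = g (p, q0) + g (p0, q)" by (simp flip: linear_add[OF g(1)] add: add.commute)
      then show ?thesis using pq(3) g(2) by simp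
    qed
    show "\<exists>S. (\<forall>i\<in>?I. 0 \<le> S i) \<and> (\<forall>z\<in>P \<times> Q. h z = (\<Sum>i\<in>?I. S i * ?U z i))"
    proof (intro exI[of _ "case_sum (T ?f) (T' ?g)"] conjI ballI)
      show "0 \<le> case_sum (T ?f) (T' ?g) i" if "i \<in> ?I" for i
        using that T[rule_format, OF f] T'[rule_format, OF g'] by auto
      fix z assume "z \<in> P \<times> Q"
      then obtain p q where z: "z = (p, q)" "p \<in> P" "q \<in> Q" by auto
      have "?f p = (\<Sum>i<k. T ?f i * U p i)" "?g q = (\<Sum>i<l. T' ?g i * U' q i)"
        using T[rule_format, OF f] T'[rule_format, OF g'] z by blast+
      then show "h z = (\<Sum>i\<in>?I. case_sum (T ?f) (T' ?g) i * ?U z i)"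
        unfolding z(1) split[of p q] by (simp add: sum.Plus)
    qed
  qed (use U U' in auto)
  then show ?thesis by (simp add: card_Plus)
qed

lemma apex_functional:
  fixes v :: "'a::real_vector"
  assumes "v \<notin> affine hull B" "B \<noteq> {}"
  obtains f :: "'a \<Rightarrow> real" where "affine_map f" "\<forall>b\<in>B. f b = 0" "f v = 1"
proof -
  obtain b where b: "b \<in> B" using assms(2) by blast
  have "affine hull B = (+) b ` span ((\<lambda>x. - b + x) ` B)"
    using affine_hull_span_gen[of b B] b by (simp add: hull_inc)
  moreover have "v = b + (v - b)" by simp
  ultimately have "v - b \<notin> span ((\<lambda>x. - b + x) ` B)"
    using assms(1) by blast
  then obtain g :: "'a \<Rightarrow> real" where g: "linear g" "\<forall>s\<in>(\<lambda>x. - b + x) ` B. g s = 0" "g (v - b) = 1"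
    by (rule exists_separating_linear)
  have "affine_map (\<lambda>x. g x - g b)" using affine_map_linear[OF g(1), of "- g b"] by simp
  moreover have "\<forall>x\<in>B. g x - g b = 0"
  proof
    fix x assume "x \<in> B"
    then have "g (- b + x) = 0" using g(2) by blast
    then show "g x - g b = 0" using linear_diff[OF g(1), of x b] by simp
  qed
  moreover have "g v - g b = 1" using g(3) linear_diff[OF g(1), of v b] by simp
  ultimately show thesis by (rule that)
qed

text \<open>
  The heart of the matter. A row of \<open>P\<close> decomposes as \<open>f = f v * f0 +
  f1\<close>, where \<open>f1\<close> vanishes at the apex and agrees with \<open>f\<close> on the
  base, and so is tight again; this is why the terms in \<open>A\<close> together with
  \<open>f0\<close> suffice for \<open>P\<close>. In both cases below, \<open>P\<close> gets the
  terms \<open>insert j A\<close> and \<open>Q\<close> gets the complement of the same set: when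
  \<open>j \<in> A\<close>, the term \<open>j\<close> is zero on the columns used for
  \<open>P\<close>, so its place is free for \<open>f0\<close>.
\<close>

lemma factorization_Times_split_apex:
  assumes apex: "v \<notin> affine hull B" and "B \<noteq> {}" and P: "P = convex hull (B \<union> {v})"
    and "Q \<noteq> {}" and "factorization (P \<times> Q) k"
  shows "\<exists>k1 k2. factorization P k1 \<and> factorization Q k2 \<and> k1 + k2 \<le> k"
proof -
  obtain U T where UT: "\<forall>z\<in>P \<times> Q. \<forall>i<k. 0 \<le> (U z i :: real)"
    "\<forall>f. tight_on (P \<times> Q) f \<longrightarrow>
       (\<forall>i<k. 0 \<le> T f i) \<and> (\<forall>z\<in>P \<times> Q. f z = (\<Sum>i<k. T f i * U z i))"
    using assms(5) unfolding factorization_def by blast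
  have U: "\<And>z i. z \<in> P \<times> Q \<Longrightarrow> i < k \<Longrightarrow> 0 \<le> (U z i :: real)"
    and T: "\<And>f i. tight_on (P \<times> Q) f \<Longrightarrow> i < k \<Longrightarrow> 0 \<le> T f i"
    and TU: "\<And>f z. tight_on (P \<times> Q) f \<Longrightarrow> z \<in> P \<times> Q \<Longrightarrow> f z = (\<Sum>i<k. T f i * U z i)"
    using UT by blast+
  have zero: "T f i * U z i = 0" if "tight_on (P \<times> Q) f" "z \<in> P \<times> Q" "i < k" "f z = 0" for f z i
  proof -
    have "(\<Sum>i<k. T f i * U z i) = 0" using TU that by metis
    moreover have "\<forall>i\<in>{..<k}. 0 \<le> T f i * U z i" using U T that by auto
    ultimately show ?thesis using that(3) by (subst (asm) sum_nonneg_eq_0_iff) auto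
  qed
  obtain b where b: "b \<in> B" using \<open>B \<noteq> {}\<close> by blast
  have BP: "B \<subseteq> P" "v \<in> P" "b \<in> P" using b by (auto simp: P hull_inc)
  obtain q0 where q0: "q0 \<in> Q" using \<open>Q \<noteq> {}\<close> by blast
  obtain f0 where f0: "affine_map f0" "\<forall>b\<in>B. f0 b = 0" "f0 v = (1::real)"
    using apex_functional[OF apex \<open>B \<noteq> {}\<close>] .
  have "\<forall>x\<in>P. 0 \<le> f0 x" using affine_map_nonneg_hull[OF f0(1), of "B \<union> {v}"] f0 by (auto simp: P)
  then have f0_tight: "tight_on P f0" using f0 b BP by (auto simp: tight_on_def)
  let ?fst = "\<lambda>f z. f (fst z)" and ?snd = "\<lambda>g z. g (snd z)"
  have fst_tight: "tight_on (P \<times> Q) (?fst f)" if "tight_on P f" for f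
    using that q0 by (auto simp: tight_on_def affine_map_fst)
  have snd_tight: "tight_on (P \<times> Q) (?snd g)" if "tight_on Q g" for g
    using that BP by (auto simp: tight_on_def affine_map_snd)
  define A where "A = {i. i < k \<and> (\<exists>f. tight_on P f \<and> f v = 0 \<and> T (?fst f) i \<noteq> 0)}"
  have A: "finite A" "A \<subseteq> {..<k}" by (auto simp: A_def)
  have U_A: "U (v, q) i = 0" if "i \<in> A" "q \<in> Q" for i q
  proof -
    from that obtain f where f: "i < k" "tight_on P f" "f v = 0" "T (?fst f) i \<noteq> 0"
      by (auto simp: A_def)
    show ?thesis using zero[OF fst_tight[OF f(2)], of "(v, q)" i] f that BP by auto
  qed
  have P_fact: "factorization P (card (insert j A))"
    if q: "q \<in> Q" and j: "\<And>p. j \<in> A \<Longrightarrow> p \<in> P \<Longrightarrow> U (p, q) j = 0" for q j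
  proof (rule factorizationI[where U = "\<lambda>p i. if i = j then f0 p else U (p, q) i"])
    show "0 \<le> (if i = j then f0 p else U (p, q) i)" if "p \<in> P" "i \<in> insert j A" for p i
      using that f0_tight U[of "(p, q)" i] A q by (auto simp: tight_on_def)
    fix f :: "'a \<Rightarrow> real" assume f: "tight_on P f"
    define f1 where "f1 x = f x - f v * f0 x" for x
    have f1: "affine_map f1" unfolding f1_def
      using affine_map_diff_mult[OF _ f0(1)] f by (simp add: tight_on_def)
    have "\<forall>x\<in>B \<union> {v}. 0 \<le> f1 x" using f f0 BP by (auto simp: f1_def tight_on_def)
    then have "\<forall>x\<in>P. 0 \<le> f1 x" using affine_map_nonneg_hull[OF f1] unfolding P by blast
    moreover have f1v: "f1 v = 0" using f0 by (simp add: f1_def)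
    ultimately have f1_tight: "tight_on P f1" using f1 BP by (auto simp: tight_on_def)
    let ?T = "T (?fst f1)"
    have sum: "f1 p = (\<Sum>i\<in>A - {j}. ?T i * U (p, q) i)" if "p \<in> P" for p
    proof -
      have "f1 p = (\<Sum>i<k. ?T i * U (p, q) i)"
        using TU[OF fst_tight[OF f1_tight], of "(p, q)"] that q by simp
      also have "\<dots> = (\<Sum>i\<in>A - {j}. ?T i * U (p, q) i)"
      proof (rule sum.mono_neutral_right)
        show "\<forall>i\<in>{..<k} - (A - {j}). ?T i * U (p, q) i = 0"
          using f1_tight f1v j[OF _ that] unfolding A_def by auto
      qed (use A in auto)
      finally show ?thesis .
    qed
    show "\<exists>S. (\<forall>i\<in>insert j A. 0 \<le> S i) \<and>
        (\<forall>p\<in>P. f p = (\<Sum>i\<in>insert j A. S i * (if i = j then f0 p else U (p, q) i)))"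
    proof (intro exI[of _ "\<lambda>i. if i = j then f v else ?T i"] conjI ballI)
      show "0 \<le> (if i = j then f v else ?T i)" if "i \<in> insert j A" for i
        using that f BP T[OF fst_tight[OF f1_tight], of i] A by (auto simp: tight_on_def)
      fix p assume p: "p \<in> P"
      have "(\<Sum>i\<in>insert j A. (if i = j then f v else ?T i) * (if i = j then f0 p else U (p, q) i))
          = f v * f0 p + (\<Sum>i\<in>A - {j}. ?T i * U (p, q) i)"
        using A by (subst sum.insert_remove) (auto intro!: sum.cong)
      also have "\<dots> = f p" using sum[OF p] by (simp add: f1_def)
      finally show "f p = (\<Sum>i\<in>insert j A. (if i = j then f v else ?T i) * (if i = j then f0 p else U (p, q) i))" ..
    qed
  qed (use A in auto)
  have Q_fact: "factorization Q (k - card J)"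
    if p: "p \<in> P" and J: "J \<subseteq> {..<k}" 
      "\<And>g q i. tight_on Q g \<Longrightarrow> q \<in> Q \<Longrightarrow> i \<in> J \<Longrightarrow> T (?snd g) i * U (p, q) i = 0" for p J
  proof -
    have "factorization Q (card ({..<k} - J))"
    proof (rule factorizationI[where U = "\<lambda>q. U (p, q)"])
      fix g :: "'b \<Rightarrow> real" assume g: "tight_on Q g"
      have "g q = (\<Sum>i\<in>{..<k} - J. T (?snd g) i * U (p, q) i)" if "q \<in> Q" for q
      proof -
        have "g q = (\<Sum>i<k. T (?snd g) i * U (p, q) i)"
          using TU[OF snd_tight[OF g], of "(p, q)"] that p by simp
        also have "\<dots> = (\<Sum>i\<in>{..<k} - J. T (?snd g) i * U (p, q) i)"
          by (rule sum.mono_neutral_right) (use J(2)[OF g that] in auto)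
        finally show ?thesis .
      qed
      then show "\<exists>S. (\<forall>i\<in>{..<k} - J. 0 \<le> S i) \<and> (\<forall>q\<in>Q. g q = (\<Sum>i\<in>{..<k} - J. S i * U (p, q) i))"
        using T[OF snd_tight[OF g]] by (intro exI[of _ "T (?snd g)"]) auto
    qed (use U p in auto)
    moreover have "card ({..<k} - J) = k - card J"
      using J(1) by (simp add: card_Diff_subset finite_subset)
    ultimately show ?thesis by simp
  qed
  show ?thesis
  proof (cases "\<exists>g j. tight_on Q g \<and> j \<in> A \<and> T (?snd g) j \<noteq> 0")
    case True
    then obtain g j where g: "tight_on Q g" "j \<in> A" "T (?snd g) j \<noteq> 0" by blast
    obtain q where q: "q \<in> Q" "g q = 0" using g(1) by (auto simp: tight_on_def)
    have "U (p, q) j = 0" if "p \<in> P" for p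
      using zero[OF snd_tight[OF g(1)], of "(p, q)" j] q that g A by auto
    then have "factorization P (card A)" using P_fact[OF q(1), of j] g(2) by (simp add: insert_absorb)
    moreover have "factorization Q (k - card A)"
      by (rule Q_fact[OF BP(2) A(2)]) (simp add: U_A)
    moreover have "card A \<le> k" using A card_mono[of "{..<k}" A] by simp
    ultimately show ?thesis by (intro exI[of _ "card A"] exI[of _ "k - card A"]) simp
  next
    case False
    have "(\<Sum>i<k. T (?fst f0) i * U (v, q0) i) \<noteq> 0"
      using TU[OF fst_tight[OF f0_tight], of "(v, q0)"] BP q0 f0 by simp
    then obtain j where j: "j < k" "T (?fst f0) j \<noteq> 0" "U (v, q0) j \<noteq> 0"
      by (rule sum.not_neutral_contains_not_neutral) auto
    then have jA: "j \<notin> A" using U_A q0 by blast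
    have "U (b, q) j = 0" if "q \<in> Q" for q
      using zero[OF fst_tight[OF f0_tight], of "(b, q)" j] that b BP f0 j by auto
    then have "factorization Q (k - card (insert j A))"
      using False j(1) A(2) by (intro Q_fact[OF BP(3)]) auto
    moreover have "factorization P (card (insert j A))" using P_fact[OF q0, of j] jA by simp
    moreover have "card (insert j A) \<le> k" using A j(1) card_mono[of "{..<k}" "insert j A"] by simp
    ultimately show ?thesis
      by (intro exI[of _ "card (insert j A)"] exI[of _ "k - card (insert j A)"]) simp
  qed
qed

section \<open>From factorizations to extensions\<close>

abbreviation (input) coord :: "(nat, real) poly_mapping \<Rightarrow> nat \<Rightarrow> real" where
  "coord \<equiv> Poly_Mapping.lookup"

abbreviation (input) support :: "(nat, real) poly_mapping \<Rightarrow> nat set" where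
  "support \<equiv> Poly_Mapping.keys"

lemma coord_scaleR: "coord (r *\<^sub>R y) i = r * coord y i"
  by (simp add: scaleR_poly_mapping_def)

lemma linear_coord: "linear (\<lambda>y. coord y i)"
  by (auto simp: linear_iff lookup_add coord_scaleR)

lemma in_support: "i \<in> support y \<longleftrightarrow> coord y i \<noteq> 0"
  by (simp add: in_keys_iff)

lemma affine_line:
  assumes "affine L" "y \<in> L" "z \<in> L"
  shows "y + t *\<^sub>R (z - y) \<in> L"
proof -
  have "(1 - t) *\<^sub>R y + t *\<^sub>R z \<in> L" using assms by (auto simp: affine_def)
  then show ?thesis by (simp add: algebra_simps)
qed

text \<open>
  A nonnegative point can be moved a little away from any point of smaller or equal support
  without leaving the nonnegative part: the coordinates that have to decrease are positive.
\<close>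

lemma extend_past_smaller_support:
  assumes "affine L" "y \<in> L" "z \<in> L" "\<forall>i. 0 \<le> coord y i" "support z \<subseteq> support y"
  obtains t where "0 < t" "y - t *\<^sub>R (z - y) \<in> L" "\<forall>i. 0 \<le> coord (y - t *\<^sub>R (z - y)) i"
proof -
  have line: "y - t *\<^sub>R (z - y) \<in> L" for t
    using affine_line[OF assms(1-3), of "- t"] by simp
  show thesis
  proof (cases "\<exists>i\<in>support y. 0 < coord (z - y) i")
    case True
    obtain t and v :: nat where t: "0 < t" "\<forall>i\<in>support y. 0 \<le> coord y i - t * coord (z - y) i"
      by (rule subtract_until_zero[of "support y" "coord y" "coord (z - y)"])
        (use assms True in \<open>auto simp: in_support\<close>)
    have "0 \<le> coord y i - t * coord (z - y) i" for i
    proof (cases "i \<in> support y")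
      case False
      then have "coord y i = 0" "coord z i = 0" using assms(5) by (auto simp: in_support)
      then show ?thesis by (simp add: lookup_minus)
    qed (use t in blast)
    then show thesis
      using t(1) line by (intro that[of t]) (auto simp: lookup_minus coord_scaleR)
  next
    case False
    have "0 \<le> coord y i - coord (z - y) i" for i
    proof (cases "i \<in> support y")
      case True
      then show ?thesis using False assms(4) by (metis diff_ge_0_iff_ge linorder_not_less order_trans)
    next
      case False
      then have "coord y i = 0" "coord z i = 0" using assms(5) by (auto simp: in_support)
      then show ?thesis by (simp add: lookup_minus)
    qed
    moreover have "coord (y - 1 *\<^sub>R (z - y)) i = coord y i - coord (z - y) i" for i
      by (simp only: lookup_minus coord_scaleR mult_1)
    ultimately show thesis
      by (intro that[OF zero_less_one line]) simp
  qed
qed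

text \<open>
  The vertices are the basic solutions \<open>X\<close>, that is, the points that are determined
  within \<open>L\<close> by their support; there is at most one for each subset of the
  coordinates. Through any other point there is a line in \<open>L\<close> along which no new
  coordinates become nonzero. Boundedness forces the line to leave the nonnegative part on both
  sides, at points with smaller support, and induction applies to these.
\<close>

lemma polytope_nonneg_part:
  assumes L: "affine L" "L \<subseteq> coord_space k"
    and E: "E = {y \<in> L. \<forall>i. 0 \<le> coord y i}"
    and bound: "\<And>y i. y \<in> E \<Longrightarrow> coord y i \<le> M i"
  shows "polytope E"
proof -
  define X where "X = {y \<in> E. \<forall>z\<in>L. support z \<subseteq> support y \<longrightarrow> z = y}"
  have "support ` X \<subseteq> Pow {..<k}" using L(2) by (auto simp: X_def E coord_space_def)
  then have "finite (support ` X)" by (rule finite_subset) simp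
  moreover have "inj_on support X" by (auto simp: inj_on_def X_def E)
  ultimately have finX: "finite X" by (rule finite_imageD)
  have convE: "convex E"
  proof -
    have "convex L" using L(1) by (rule affine_imp_convex)
    then show ?thesis by (auto simp: convex_def E lookup_add coord_scaleR)
  qed
  have "y \<in> convex hull X" if "y \<in> E" for y
    using that
  proof (induction "card (support y)" arbitrary: y rule: less_induct)
    case less
    show ?case
    proof (cases "y \<in> X")
      case True
      then show ?thesis by (rule hull_inc)
    next
      case False
      then obtain z where z: "z \<in> L" "support z \<subseteq> support y" "z \<noteq> y"
        using less.prems by (auto simp: X_def)
      have y: "y \<in> L" "\<forall>i. 0 \<le> coord y i" using less.prems by (auto simp: E)
      define d where "d = z - y"
      have "d \<noteq> 0" using z by (simp add: d_def)
      have d_supp: "coord d i = 0" if "i \<notin> support y" for i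
        using that z(2) by (auto simp: d_def lookup_minus in_support)
      have line: "y + t *\<^sub>R d \<in> L" for t unfolding d_def using affine_line[OF L(1) y(1) z(1)] .
      have pos: "\<exists>i\<in>support y. 0 < r * coord d i" if "r \<noteq> 0" for r
      proof (rule ccontr)
        assume "\<not> ?thesis"
        then have le: "r * coord d i \<le> 0" for i using d_supp by (cases "i \<in> support y") force+
        obtain i where i: "coord d i \<noteq> 0" using \<open>d \<noteq> 0\<close> by (metis in_support keys_eq_empty ex_in_conv)
        with le \<open>r \<noteq> 0\<close> have neg: "r * coord d i < 0" by (metis le_less mult_eq_0_iff)
        \<comment> \<open>with this step coordinate \<open>i\<close> exceeds its bound\<close>
        define s where "s = (\<bar>M i\<bar> + 1) / (- (r * coord d i))"
        have "0 < s" using neg unfolding s_def by (intro divide_pos_pos) auto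
        have "s * (- (r * coord d i)) = \<bar>M i\<bar> + 1" using i \<open>r \<noteq> 0\<close> unfolding s_def by simp
        then have s: "s * (r * coord d i) = - (\<bar>M i\<bar> + 1)" by simp
        have "0 \<le> coord (y + (- s * r) *\<^sub>R d) j" for j
        proof -
          have "s * (r * coord d j) \<le> 0" using \<open>0 < s\<close> le by (simp add: mult_nonneg_nonpos)
          moreover have "coord (y + (- s * r) *\<^sub>R d) j = coord y j - s * (r * coord d j)"
            by (simp add: lookup_add coord_scaleR lookup_minus)
          ultimately show ?thesis using y(2) by (smt (verit))
        qed
        then have "y + (- s * r) *\<^sub>R d \<in> E" using line[of "- s * r"] by (simp add: E)
        from bound[OF this, of i] have "coord y i - s * (r * coord d i) \<le> M i"
          by (simp add: lookup_add coord_scaleR lookup_minus)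
        with s y(2)[rule_format, of i] show False by linarith
      qed
      have half: "\<exists>t>0. y - (t * r) *\<^sub>R d \<in> convex hull X" if r: "r \<noteq> 0" for r
      proof -
        have 1: "\<forall>i\<in>support y. 0 \<le> coord y i" using y(2) by blast
        have 2: "\<forall>i\<in>support y. coord y i = 0 \<longrightarrow> r * coord d i = 0" by (simp add: in_support)
        obtain t i where t: "0 < t" "\<forall>i\<in>support y. 0 \<le> coord y i - t * (r * coord d i)"
          "i \<in> support y" "0 < coord y i" "coord y i - t * (r * coord d i) = 0"
          by (rule subtract_until_zero[OF finite_keys 1 pos[OF r] 2])
        let ?y = "y - (t * r) *\<^sub>R d"
        have co: "coord ?y j = coord y j - t * (r * coord d j)" for j
          by (simp add: lookup_minus coord_scaleR)
        have supp: "support ?y \<subseteq> support y"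
          using d_supp by (auto simp: in_support co)
        have "i \<notin> support ?y" using t by (simp add: in_support co)
        with supp t(3) have "support ?y \<subset> support y" by blast
        then have "card (support ?y) < card (support y)" by (intro psubset_card_mono) auto
        moreover have "?y \<in> E"
        proof -
          have "?y \<in> L" using line[of "- (t * r)"] by simp
          moreover have "0 \<le> coord ?y j" for j
          proof (cases "j \<in> support y")
            case True
            then show ?thesis using t(2) by (simp add: co)
          next
            case False
            then show ?thesis using d_supp[OF False] by (simp add: co in_support)
          qed
          ultimately show ?thesis by (simp add: E)
        qed
        ultimately have "?y \<in> convex hull X" by (rule less.hyps)
        then show ?thesis using t(1) by blast
      qed
      obtain t where t: "0 < t" "y - t *\<^sub>R d \<in> convex hull X" using half[of 1] by auto
      obtain s where s: "0 < s" "y + s *\<^sub>R d \<in> convex hull X" using half[of "- 1"] by auto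
      have "(s / (s + t)) *\<^sub>R (y - t *\<^sub>R d) + (t / (s + t)) *\<^sub>R (y + s *\<^sub>R d) \<in> convex hull X"
      proof (rule convexD[OF convex_convex_hull t(2) s(2)])
        show "s / (s + t) + t / (s + t) = 1" 
          using s(1) t(1) by (simp flip: add_divide_distrib)
      qed (use s(1) t(1) in auto)
      moreover have "(s / (s + t)) *\<^sub>R (y - t *\<^sub>R d) + (t / (s + t)) *\<^sub>R (y + s *\<^sub>R d)
          = (s / (s + t) + t / (s + t)) *\<^sub>R y"
        by (simp add: algebra_simps)
      moreover have "s / (s + t) + t / (s + t) = 1"
        using s(1) t(1) by (simp flip: add_divide_distrib)
      ultimately show ?thesis by simp
    qed
  qed
  moreover have "convex hull X \<subseteq> E" using convE by (intro hull_minimal) (auto simp: X_def)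
  ultimately show ?thesis using finX unfolding polytope_def by blast
qed

text \<open>
  By convexity a nonempty face has a point \<open>z\<close> whose support \<open>K\<close>
  contains the supports of all its points. From \<open>z\<close> one can move a little away from
  any point of \<open>E\<close> supported in \<open>K\<close>, so \<open>z\<close> lies inside a
  segment ending there, and the face contains that point.
\<close>

lemma face_eq_support:
  assumes L: "affine L" "L \<subseteq> coord_space k"
    and E: "E = {y \<in> L. \<forall>i. 0 \<le> coord y i}"
    and F: "F face_of E" "F \<noteq> {}"
  obtains K where "K \<subseteq> {..<k}" "F = {y \<in> E. support y \<subseteq> K}"
proof -
  have FE: "F \<subseteq> E" "convex F" using F(1) by (auto simp: face_of_def)
  have supp_k: "support y \<subseteq> {..<k}" if "y \<in> F" for y
    using that FE(1) L(2) by (auto simp: E coord_space_def)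
  have "\<forall>y\<in>F. card (support y) \<le> k"
  proof
    fix y assume "y \<in> F"
    from card_mono[OF _ supp_k[OF this]] show "card (support y) \<le> k" by simp
  qed
  then have "(\<lambda>y. card (support y)) ` F \<subseteq> {..k}" by blast
  then have "finite ((\<lambda>y. card (support y)) ` F)" by (rule finite_subset) simp
  then have "Max ((\<lambda>y. card (support y)) ` F) \<in> (\<lambda>y. card (support y)) ` F"
    using F(2) by (intro Max_in) auto
  then obtain z where z: "z \<in> F" "card (support z) = Max ((\<lambda>y. card (support y)) ` F)" by auto
  have max: "card (support y) \<le> card (support z)" if "y \<in> F" for y
    using z(2) that \<open>finite _\<close> by simp
  have nn: "0 \<le> coord y i" if "y \<in> E" for y i using that by (simp add: E)
  have sub: "support y \<subseteq> support z" if y: "y \<in> F" for y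
  proof (rule ccontr)
    assume "\<not> support y \<subseteq> support z"
    let ?m = "(1 / 2) *\<^sub>R z + (1 / 2) *\<^sub>R y"
    have "?m \<in> F" by (rule convexD[OF FE(2) z(1) y]) auto
    have "i \<in> support ?m \<longleftrightarrow> i \<in> support z \<or> i \<in> support y" for i
    proof -
      have "0 \<le> coord y i" "0 \<le> coord z i" using nn FE(1) y z(1) by blast+
      moreover have "coord ?m i = 1 / 2 * coord z i + 1 / 2 * coord y i"
        by (simp only: lookup_add coord_scaleR)
      ultimately show ?thesis unfolding in_support by linarith
    qed
    then have "support ?m = support z \<union> support y" by blast
    then have "support z \<subset> support ?m" using \<open>\<not> support y \<subseteq> support z\<close> by blast
    then have "card (support z) < card (support ?m)" by (intro psubset_card_mono) auto
    with max[OF \<open>?m \<in> F\<close>] show False by simp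
  qed
  have "y \<in> F" if y: "y \<in> E" "support y \<subseteq> support z" for y
  proof (cases "y = z")
    case False
    have zE: "z \<in> E" using z FE by blast
    then have zL: "z \<in> L" "\<forall>i. 0 \<le> coord z i" and yL: "y \<in> L" using y(1) by (auto simp: E)
    obtain t where t: "0 < t" "z - t *\<^sub>R (y - z) \<in> L" "\<forall>i. 0 \<le> coord (z - t *\<^sub>R (y - z)) i"
      using extend_past_smaller_support[OF L(1) zL(1) yL zL(2) y(2)] .
    define w where "w = z - t *\<^sub>R (y - z)"
    have wE: "w \<in> E" using t by (simp add: E w_def)
    have "w \<noteq> y"
    proof
      assume "w = y"
      then have "z - t *\<^sub>R (y - z) = y" unfolding w_def .
      moreover have "(1 + t) *\<^sub>R (y - z) = y - (z - t *\<^sub>R (y - z))" by (simp add: algebra_simps)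
      ultimately have "(1 + t) *\<^sub>R (y - z) = 0" by (simp only: diff_self)
      then show False using False t(1) by simp
    qed
    moreover have "z = (1 - t / (1 + t)) *\<^sub>R w + (t / (1 + t)) *\<^sub>R y"
    proof -
      have c: "1 - t / (1 + t) = 1 / (1 + t)" using t(1) by (simp add: field_simps)
      have "(1 / (1 + t)) *\<^sub>R w + (t / (1 + t)) *\<^sub>R y = (1 / (1 + t)) *\<^sub>R (w + t *\<^sub>R y)"
        by (simp add: algebra_simps)
      also have "w + t *\<^sub>R y = (1 + t) *\<^sub>R z" by (simp add: w_def algebra_simps)
      finally show ?thesis using t(1) c by simp
    qed
    moreover have "0 < t / (1 + t)" "t / (1 + t) < 1" using t(1) by auto
    ultimately have "z \<in> open_segment w y"
      unfolding in_segment by blast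
    then show ?thesis using F(1) wE y(1) z(1) unfolding face_of_def by blast
  qed (use z in simp)
  then have "F = {y \<in> E. support y \<subseteq> support z}" using sub FE(1) by blast
  then show thesis using that[of "support z"] supp_k[OF z(1)] by blast
qed

text \<open>
  A facet \<open>F\<close> lies in one of the proper faces \<open>coord y i = 0\<close>. That face
  has dimension between those of \<open>F\<close> and \<open>E\<close>, and not the latter, so it
  has the same affine hull as \<open>F\<close> and, by the description of faces by supports,
  equals \<open>F\<close>. Hence the facet is determined by \<open>i\<close>.
\<close>

lemma card_facets_nonneg_part_le:
  assumes L: "affine L" "L \<subseteq> coord_space k"
    and E: "E = {y \<in> L. \<forall>i. 0 \<le> coord y i}"
  shows "card {F. F vs_facet_of E} \<le> k"
proof -
  have fin_span: "finite C" if "independent C" "C \<subseteq> (\<lambda>x. x - a) ` E" "a \<in> E" for C a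
  proof -
    let ?B = "(\<lambda>i. Poly_Mapping.single i (1::real)) ` {..<k}"
    have "y \<in> span ?B" if y: "support y \<subseteq> {..<k}" for y
    proof -
      have "y = (\<Sum>i<k. coord y i *\<^sub>R Poly_Mapping.single i (1::real))"
      proof (rule poly_mapping_eqI)
        fix j
        have "coord (\<Sum>i<k. coord y i *\<^sub>R Poly_Mapping.single i (1::real)) j
            = (\<Sum>i<k. if i = j then coord y i else 0)"
          by (simp add: lookup_sum coord_scaleR lookup_single when_def if_distrib cong: if_cong)
        also have "\<dots> = coord y j" using y by (auto simp: in_support subset_iff)
        finally show "coord y j = coord (\<Sum>i<k. coord y i *\<^sub>R Poly_Mapping.single i (1::real)) j" ..
      qed
      also have "\<dots> \<in> span ?B" by (intro span_sum span_scale span_base) auto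
      finally show ?thesis .
    qed
    moreover have "support (x - a) \<subseteq> {..<k}" if "x \<in> E" for x
    proof -
      have "support x \<subseteq> {..<k}" "support a \<subseteq> {..<k}"
        using that \<open>a \<in> E\<close> L(2) unfolding E coord_space_def by blast+
      then show ?thesis using keys_diff[of x a] by blast
    qed
    ultimately have "C \<subseteq> span ?B" using that(2) by blast
    then show ?thesis using independent_span_bound[of ?B C] that(1) by blast
  qed
  let ?Z = "\<lambda>i. {y \<in> E. coord y i = 0}"
  have "F \<in> ?Z ` {..<k}" if "F vs_facet_of E" for F
  proof -
    have F: "F face_of E" "F \<noteq> {}" and dim: "vs_aff_dim F = vs_aff_dim E - 1"
      using that by (auto simp: vs_facet_of_def)
    obtain K where K: "K \<subseteq> {..<k}" "F = {y \<in> E. support y \<subseteq> K}"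
      using face_eq_support[OF L E F] .
    obtain a where a: "a \<in> F" using F(2) by blast
    have "a \<in> E" using a K by blast
    have "F \<noteq> E" using dim by auto
    then obtain y i where yi: "y \<in> E" "i \<in> support y" "i \<notin> K" using K(2) by blast
    then have ik: "i < k" using L(2) by (auto simp: E coord_space_def)
    have FZ: "F \<subseteq> ?Z i" using K(2) yi(3) by (auto simp: in_support subset_iff)
    let ?s = "\<lambda>x. x - a"
    obtain C where C: "C \<subseteq> ?s ` F" "independent C" "?s ` F \<subseteq> span C"
      using maximal_independent_subset by blast
    have CZ: "C \<subseteq> ?s ` ?Z i" using C(1) FZ by blast
    obtain C1 where C1: "C \<subseteq> C1" "C1 \<subseteq> ?s ` ?Z i" "independent C1" "?s ` ?Z i \<subseteq> span C1"
      using maximal_independent_subset_extend[OF CZ C(2)] .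
    have "C1 \<subseteq> ?s ` E" using C1(2) by blast
    then obtain C2 where C2: "C1 \<subseteq> C2" "C2 \<subseteq> ?s ` E" "independent C2" "?s ` E \<subseteq> span C2"
      using maximal_independent_subset_extend[OF _ C1(3)] by metis
    have fin: "finite C2" using fin_span[OF C2(3,2) \<open>a \<in> E\<close>] .
    then have fin1: "finite C1" "finite C" using C1(1) C2(1) by (auto intro: finite_subset)
    have "int (card C) = int (card C2) - 1"
      using dim vs_aff_dim_eq_card[OF a C(2) fin1(2) C(1,3)]
        vs_aff_dim_eq_card[OF \<open>a \<in> E\<close> C2(3) fin C2(2,4)] by simp
    moreover have "C1 \<noteq> C2"
    proof
      assume "C1 = C2"
      have ai: "coord a i = 0" using a FZ by blast
      have "coord c i = 0" if "c \<in> C1" for c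
      proof -
        obtain x where "x \<in> ?Z i" "c = x - a" using \<open>c \<in> C1\<close> C1(2) by blast
        then show ?thesis using ai by (simp add: lookup_minus)
      qed
      then have "coord c i = 0" if "c \<in> span C1" for c
        using linear_eq_0_on_span[OF linear_coord] that by blast
      moreover have "y - a \<in> span C1" using C2(4) yi(1) \<open>C1 = C2\<close> by blast
      ultimately have "coord (y - a) i = 0" by blast
      then show False using yi(2) ai by (simp add: lookup_minus in_support)
    qed
    then have "card C1 < card C2" using C2(1) fin by (intro psubset_card_mono) auto
    ultimately have "card C1 \<le> card C" by linarith
    then have "C1 = C" using C1(1) fin1 by (metis card_seteq)
    have "?Z i \<subseteq> F"
    proof
      fix z assume z: "z \<in> ?Z i"
      then have zs: "z - a \<in> span C" using C1(4) \<open>C1 = C\<close> by blast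
      have "coord z j = 0" if "j \<notin> K" for j
      proof -
        have F0: "coord x j = 0" if "x \<in> F" for x
          using that K(2) \<open>j \<notin> K\<close> by (auto simp: in_support subset_iff)
        have "coord c j = 0" if "c \<in> C" for c
        proof -
          obtain x where "x \<in> F" "c = x - a" using \<open>c \<in> C\<close> C(1) by blast
          then show ?thesis using F0 a by (simp add: lookup_minus)
        qed
        then have "coord c j = 0" if "c \<in> span C" for c
          using linear_eq_0_on_span[OF linear_coord] that by blast
        from this[OF zs] F0[OF a] show ?thesis by (simp add: lookup_minus)
      qed
      then show "z \<in> F" using z K(2) by (auto simp: in_support)
    qed
    then have "F = ?Z i" using FZ by blast
    then show ?thesis using ik by blast
  qed
  then have "{F. F vs_facet_of E} \<subseteq> ?Z ` {..<k}" by blast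
  then have "card {F. F vs_facet_of E} \<le> card (?Z ` {..<k})" by (intro card_mono) auto
  also have "\<dots> \<le> k" using card_image_le[of "{..<k}" ?Z] by simp
  finally show ?thesis .
qed

lemma coordinates_of_span:
  fixes C :: "'a::real_vector set"
  assumes "independent C" "finite C"
  obtains h :: "'a \<Rightarrow> 'a \<Rightarrow> real"
  where "\<And>c. linear (h c)" "\<And>w. w \<in> span C \<Longrightarrow> (\<Sum>c\<in>C. h c w *\<^sub>R c) = w"
proof -
  have "\<exists>g :: 'a \<Rightarrow> real. linear g \<and> (\<forall>x\<in>C. g x = (if x = c then 1 else 0))" for c
    using linear_independent_extend[OF assms(1), of "\<lambda>x. if x = c then 1 else 0"] .
  then obtain h :: "'a \<Rightarrow> 'a \<Rightarrow> real"
    where h: "\<And>c. linear (h c)" "\<And>c x. x \<in> C \<Longrightarrow> h c x = (if x = c then 1 else 0)"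
    by metis
  have "linear (\<lambda>w. \<Sum>c\<in>C. h c w *\<^sub>R c)"
    using h(1) by (intro linear_compose_sum ballI) (auto simp: linear_iff scaleR_left_distrib)
  moreover have "linear (\<lambda>w::'a. w)" by (simp add: linear_iff)
  moreover have "(\<Sum>c\<in>C. h c w *\<^sub>R c) = w" if "w \<in> C" for w
    using assms(2) that by (simp add: h(2) if_distrib[of "\<lambda>r. r *\<^sub>R _"] cong: if_cong)
  ultimately have "(\<Sum>c\<in>C. h c w *\<^sub>R c) = w" if "w \<in> span C" for w
    using linear_eq_on_span[of "\<lambda>w. \<Sum>c\<in>C. h c w *\<^sub>R c" "\<lambda>w. w" C w] that by blast
  then show thesis using h(1) that by blast
qed

text \<open>
  The extension consists of all \<open>y \<ge> 0\<close> for which \<open>T f \<bullet> y\<close>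
  is the value of \<open>f\<close> at a common point \<open>\<phi> y\<close>, for every tight
  \<open>f\<close>. The map \<open>\<phi>\<close> can be given in advance: after subtracting its
  minimum, each affine coordinate on \<open>P\<close> becomes tight, so \<open>T\<close> expresses
  it linearly in \<open>y\<close>. The points \<open>\<phi> y\<close> lie in \<open>P\<close>
  because a separating affine function would become a tight one. A coordinate that occurs in no
  row would be unbounded; it is set to 0 by restricting to \<open>J\<close>.
\<close>

lemma factorization_imp_extension:
  fixes P :: "'a::real_vector set"
  assumes "polytope P" "P \<noteq> {}" "factorization P k"
  shows "\<exists>n E (f :: (nat, real) poly_mapping \<Rightarrow> 'a). polytope E \<and> E \<subseteq> coord_space n \<and> 
    affine_map f \<and> f ` E = P \<and> card {F. F vs_facet_of E} \<le> k"
proof -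
  obtain V where V: "finite V" "P = convex hull V" using assms(1) by (auto simp: polytope_def)
  then have "V \<noteq> {}" using assms(2) by auto
  then obtain p0 where p0: "p0 \<in> V" by blast
  obtain U T where U: "\<forall>p\<in>P. \<forall>i<k. 0 \<le> (U p i :: real)"
    and T: "\<forall>f. tight_on P f \<longrightarrow> (\<forall>i<k. 0 \<le> T f i) \<and> (\<forall>p\<in>P. f p = (\<Sum>i<k. T f i * U p i))"
    using assms(3) unfolding factorization_def by blast
  \<comment> \<open>only the coordinates in \<open>J\<close> are bounded on the extension\<close>
  define J where "J = {i. i < k \<and> (\<exists>f. tight_on P f \<and> 0 < T f i)}"
  have T_J: "T f i = 0" if "tight_on P f" "i < k" "i \<notin> J" for f i
    using that T by (force simp: J_def)
  define u where "u p = (\<Sum>i\<in>J. Poly_Mapping.single i (U p i))" for p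
  have coord_u: "coord (u p) i = (if i \<in> J then U p i else 0)" for p i
    by (simp add: u_def lookup_sum lookup_single when_def J_def)
  obtain C where C: "C \<subseteq> (\<lambda>x. x - p0) ` V" "independent C" "(\<lambda>x. x - p0) ` V \<subseteq> span C"
    using maximal_independent_subset by blast
  have finC: "finite C" using C(1) V(1) by (meson finite_imageI finite_subset)
  obtain h :: "'a \<Rightarrow> 'a \<Rightarrow> real" where h: "\<And>c. linear (h c)" 
    "\<And>w. w \<in> span C \<Longrightarrow> (\<Sum>c\<in>C. h c w *\<^sub>R c) = w"
    by (rule coordinates_of_span[OF C(2) finC]) blast
  define m where "m c = Min (h c ` V)" for c
  have h_aff: "affine_map (h c)" for c using affine_map_linear[OF h(1), of c 0] by simp
  have tight: "tight_on P (\<lambda>x. h c x - m c)" for c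
    unfolding V(2) m_def using tight_on_hullI[OF V(1) \<open>V \<noteq> {}\<close> h_aff] .
  define S where "S c = T (\<lambda>x. h c x - m c)" for c
  \<comment> \<open>for \<open>y = u p\<close> the coefficient of \<open>c\<close> is \<open>h c p - h c p0\<close>, the coordinate of \<open>p - p0\<close>\<close>
  define \<phi> where "\<phi> y = (\<Sum>c\<in>C. (\<Sum>i<k. S c i * coord y i) *\<^sub>R c) + 
      (p0 + (\<Sum>c\<in>C. (m c - h c p0) *\<^sub>R c))" for y
  have "linear (\<lambda>y. \<Sum>c\<in>C. (\<Sum>i<k. S c i * coord y i) *\<^sub>R c)"
    by (auto simp: linear_iff lookup_add coord_scaleR scaleR_sum_right sum.distrib 
        scaleR_left_distrib sum_distrib_left algebra_simps)
  then have \<phi>_aff: "affine_map \<phi>" unfolding \<phi>_def by (rule affine_map_linear)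
  have sum_u: "(\<Sum>i<k. T f i * coord (u p) i) = f p" if "tight_on P f" "p \<in> P" for f p
  proof -
    have "(\<Sum>i<k. T f i * coord (u p) i) = (\<Sum>i<k. T f i * U p i)"
      using T_J[OF that(1)] by (intro sum.cong) (auto simp: coord_u)
    then show ?thesis using T that by simp
  qed
  have \<phi>_u: "\<phi> (u p) = p" if p: "p \<in> P" for p
  proof -
    have "p - p0 \<in> span ((\<lambda>x. x - p0) ` V)" using span_shifted_hull p V(2) by blast
    then have w: "p - p0 \<in> span C" using C(3) by (metis span_minimal subsetD subspace_span)
    have "\<phi> (u p) = (\<Sum>c\<in>C. (h c p - m c) *\<^sub>R c) + (p0 + (\<Sum>c\<in>C. (m c - h c p0) *\<^sub>R c))"
      unfolding \<phi>_def S_def using sum_u[OF tight p] by simp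
    also have "\<dots> = (\<Sum>c\<in>C. h c (p - p0) *\<^sub>R c) + p0"
      by (simp add: linear_diff[OF h(1)] algebra_simps sum.distrib sum_subtractf)
    also have "\<dots> = p" using h(2)[OF w] by simp
    finally show ?thesis .
  qed
  define L where "L = {y. support y \<subseteq> J \<and> (\<forall>f. tight_on P f \<longrightarrow> f (\<phi> y) = (\<Sum>i<k. T f i * coord y i))}"
  define E where "E = {y \<in> L. \<forall>i. 0 \<le> coord y i}"
  have L_k: "L \<subseteq> coord_space k" by (auto simp: L_def coord_space_def J_def)
  have L_aff: "affine L"
    unfolding affine_def
  proof (intro ballI allI impI)
    fix x y and a b :: real assume xy: "x \<in> L" "y \<in> L" and ab: "a + b = 1"
    have "support (a *\<^sub>R x + b *\<^sub>R y) \<subseteq> J"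
    proof
      fix i assume i: "i \<in> support (a *\<^sub>R x + b *\<^sub>R y)"
      show "i \<in> J"
      proof (rule ccontr)
        assume "i \<notin> J"
        then have "coord x i = 0" "coord y i = 0" using xy by (auto simp: L_def in_support subset_iff)
        then show False using i by (simp add: in_support lookup_add coord_scaleR)
      qed
    qed
    moreover have "f (\<phi> (a *\<^sub>R x + b *\<^sub>R y)) = (\<Sum>i<k. T f i * coord (a *\<^sub>R x + b *\<^sub>R y) i)"
      if f: "tight_on P f" for f
    proof -
      have aff: "affine_map f" using f by (simp add: tight_on_def)
      have "f (\<phi> x) = (\<Sum>i<k. T f i * coord x i)" "f (\<phi> y) = (\<Sum>i<k. T f i * coord y i)"
        using xy f by (auto simp: L_def)
      then show ?thesis
        using ab by (simp add: affine_map_comb[OF \<phi>_aff] affine_map_comb[OF aff] lookup_add coord_scaleR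
            sum.distrib sum_distrib_left algebra_simps)
    qed
    ultimately show "a *\<^sub>R x + b *\<^sub>R y \<in> L" by (simp add: L_def)
  qed
  have \<phi>_P: "\<phi> y \<in> P" if y: "y \<in> E" for y
  proof (rule ccontr)
    assume "\<phi> y \<notin> P"
    then obtain f where f: "affine_map f" "\<forall>v\<in>V. 0 \<le> f v" "f (\<phi> y) < (0::real)"
      using separating_affine_map[OF V(1)] unfolding V(2) by blast
    let ?f = "\<lambda>x. f x - Min (f ` V)"
    have ft: "tight_on P ?f" using tight_on_hullI[OF V(1) \<open>V \<noteq> {}\<close> f(1)] by (simp add: V(2))
    have "0 \<le> Min (f ` V)" using V(1) \<open>V \<noteq> {}\<close> f(2) by simp
    moreover have "?f (\<phi> y) = (\<Sum>i<k. T ?f i * coord y i)" using y ft unfolding E_def L_def by blast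
    moreover have "0 \<le> (\<Sum>i<k. T ?f i * coord y i)"
    proof (intro sum_nonneg mult_nonneg_nonneg)
      fix i assume "i \<in> {..<k}"
      then show "0 \<le> T ?f i" using T ft by blast
      show "0 \<le> coord y i" using y by (simp add: E_def)
    qed
    ultimately show False using f(3) by linarith
  qed
  have u_E: "u p \<in> E" if p: "p \<in> P" for p
  proof -
    have "support (u p) \<subseteq> J" by (auto simp: in_support coord_u split: if_splits)
    then have "u p \<in> L" using sum_u[OF _ p] \<phi>_u[OF p] by (simp add: L_def)
    then show ?thesis using U p by (simp add: E_def coord_u J_def)
  qed
  have "\<phi> ` E = P"
  proof
    show "P \<subseteq> \<phi> ` E" using u_E \<phi>_u by (metis image_eqI subsetI)
  qed (use \<phi>_P in blast)
  have "\<exists>M. \<forall>y\<in>E. coord y i \<le> M" for i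
  proof (cases "i \<in> J")
    case True
    then obtain f where f: "i < k" "tight_on P f" "0 < T f i" by (auto simp: J_def)
    have "coord y i \<le> Max (f ` V) / T f i" if y: "y \<in> E" for y
    proof -
      have nn: "0 \<le> T f j * coord y j" if "j < k" for j
        using T f(2) y that by (simp add: E_def)
      have "T f i * coord y i \<le> (\<Sum>j<k. T f j * coord y j)"
        by (rule member_le_sum) (use f nn in auto)
      also have "\<dots> = f (\<phi> y)" using y f(2) by (simp add: E_def L_def)
      also have "\<dots> \<le> Max (f ` V)"
      proof (rule affine_map_le_hull[of "\<lambda>_. Max (f ` V)" f V])
        show "affine_map f" using f(2) by (simp add: tight_on_def)
        show "\<phi> y \<in> convex hull V" using \<phi>_P[OF y] V(2) by simp
      qed (use V(1) in \<open>auto simp: affine_map_const\<close>)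
      finally show ?thesis using f(3) by (simp add: field_simps)
    qed
    then show ?thesis by blast
  next
    case False
    then have "coord y i = 0" if "y \<in> E" for y
      using that by (auto simp: E_def L_def in_support subset_iff)
    then show ?thesis by (intro exI[of _ 0]) simp
  qed
  then obtain M where M: "\<And>y i. y \<in> E \<Longrightarrow> coord y i \<le> M i" by metis
  have "polytope E" using polytope_nonneg_part[OF L_aff L_k E_def M] .
  moreover have "E \<subseteq> coord_space k" using L_k by (auto simp: E_def)
  moreover have "card {F. F vs_facet_of E} \<le> k" using card_facets_nonneg_part_le[OF L_aff L_k E_def] .
  ultimately show ?thesis using \<phi>_aff \<open>\<phi> ` E = P\<close> by blast
qed

text \<open>
  The polytope \<open>P\<close> is an extension of itself up to the choice of the ambient space,
  so both minima are taken over nonempty sets.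
\<close>

lemma xc_eq_Least_factorization:
  fixes P :: "'a::real_vector set"
  assumes "polytope P" "P \<noteq> {}"
  shows "xc P = (LEAST k. factorization P k)"
proof (rule antisym)
  let ?Q = "\<lambda>k. \<exists>n E (f :: (nat, real) poly_mapping \<Rightarrow> 'a).
     polytope E \<and> E \<subseteq> coord_space n \<and> affine_map f \<and> f ` E = P \<and> card {F. F vs_facet_of E} = k"
  have xc: "xc P = (LEAST k. ?Q k)" by (simp add: xc_def)
  have "factorization P (card {F. F vs_facet_of P})" using factorization_card_facets[OF assms(1)] .
  then have least: "factorization P (LEAST k. factorization P k)" by (rule LeastI)
  from factorization_imp_extension[OF assms this] obtain k where k: "k \<le> (LEAST k. factorization P k)" "?Q k"
    by blast
  then have "xc P \<le> k" unfolding xc by (intro Least_le)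
  then show "xc P \<le> (LEAST k. factorization P k)" using k by simp
  have "?Q (xc P)" unfolding xc using k(2) by (rule LeastI)
  then obtain E and f :: "(nat, real) poly_mapping \<Rightarrow> 'a" where E: "polytope E" "affine_map f" 
    "f ` E = P" "card {F. F vs_facet_of E} = xc P" by blast
  then have "factorization P (xc P)"
    using factorization_image[OF factorization_card_facets[OF E(1)] E(2)] by simp
  then show "(LEAST k. factorization P k) \<le> xc P" by (rule Least_le)
qed

lemma factorization_xc: "polytope P \<Longrightarrow> P \<noteq> {} \<Longrightarrow> factorization P (xc P)"
  by (metis xc_eq_Least_factorization LeastI factorization_card_facets)

lemma xc_le: "polytope P \<Longrightarrow> P \<noteq> {} \<Longrightarrow> factorization P k \<Longrightarrow> xc P \<le> k"
  by (simp add: xc_eq_Least_factorization Least_le)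

lemma factorization_Times_split_pyramid:
  assumes "pyramid P" "P \<noteq> {}" "Q \<noteq> {}" "factorization (P \<times> Q) k"
  shows "\<exists>k1 k2. factorization P k1 \<and> factorization Q k2 \<and> k1 + k2 \<le> k"
proof -
  obtain B v where Bv: "v \<notin> affine hull B" "P = convex hull (B \<union> {v})"
    using assms(1) by (auto simp: pyramid_def)
  show ?thesis
  proof (cases "B = {}")
    case True
    \<comment> \<open>a pyramid over the empty base is a point, which has rank 0\<close>
    then have "P = {v}" using Bv by simp
    have "factorization P (card ({} :: nat set))"
      by (rule factorizationI[where U = "\<lambda>_ _. 0"]) (auto simp: \<open>P = {v}\<close> tight_on_def)
    then have "factorization P 0" by simp
    moreover have "affine_map (snd :: 'a \<times> 'b \<Rightarrow> 'b)" using affine_map_linear[OF linear_snd, of 0] by simp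
    from factorization_image[OF assms(4) this] have "factorization Q k" using assms(2) by simp
    ultimately show ?thesis by (metis add_0 order_refl)
  next
    case False
    then show ?thesis using factorization_Times_split_apex[OF Bv(1) False Bv(2) assms(3,4)] by blast
  qed
qed

theorem theorem1:
  fixes P :: "'a::real_vector set" and Q :: "'b::real_vector set"
  assumes "polytope P" and "P \<noteq> {}"
    and "polytope Q" and "Q \<noteq> {}"
    and "pyramid P \<or> pyramid Q"
  shows "xc (P \<times> Q) = xc P + xc Q"
proof (rule antisym)
  obtain V W where "finite V" "P = convex hull V" "finite W" "Q = convex hull W"
    using assms(1,3) by (auto simp: polytope_def)
  then have poly: "polytope (P \<times> Q)"
    by (auto simp: polytope_def simp flip: convex_hull_Times)
  have ne: "P \<times> Q \<noteq> {}" using assms by simp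
  show "xc (P \<times> Q) \<le> xc P + xc Q"
    using assms by (intro xc_le[OF poly ne] factorization_Times factorization_xc)
  have PQ: "factorization (P \<times> Q) (xc (P \<times> Q))" using factorization_xc[OF poly ne] .
  have "\<exists>k1 k2. factorization P k1 \<and> factorization Q k2 \<and> k1 + k2 \<le> xc (P \<times> Q)"
    using assms(5)
  proof
    assume "pyramid P"
    then show ?thesis using factorization_Times_split_pyramid[OF _ assms(2,4) PQ] by blast
  next
    assume "pyramid Q"
    have "linear (prod.swap :: 'a \<times> 'b \<Rightarrow> 'b \<times> 'a)" by (auto simp: linear_iff)
    from affine_map_linear[OF this, of 0] have "affine_map (prod.swap :: 'a \<times> 'b \<Rightarrow> 'b \<times> 'a)" by simp
    from factorization_image[OF PQ this] have "factorization (Q \<times> P) (xc (P \<times> Q))"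
      by (simp add: product_swap)
    from factorization_Times_split_pyramid[OF \<open>pyramid Q\<close> assms(4,2) this] show ?thesis
      by (metis add.commute)
  qed
  then show "xc P + xc Q \<le> xc (P \<times> Q)"
    using xc_le[OF assms(1,2)] xc_le[OF assms(3,4)] by (meson add_mono order_trans)
qed

end
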